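(* Let $1\le p<\infty$, $-\tfrac12\le\alpha\le 0$, and let $\beta\ge 0$ be a fixed real number; consider positive integers $n>\beta$. Then for every fixed $R>0$ and every $f\in L_p([0,R])$, $$\lim_{n\to\infty}\big\|M_n^{(\alpha,\beta)}[f]-f\big\|_{L_p([0,R])}=0.$$
   Context: For $k=0,1,2,\dots$ and $x\ge 0$ put $\psi_{n,k}(x)=\dfrac{(nx)^k e^{-nx}}{k!}$. For $n>\beta$ and $\alpha>-1$ the operator $M_n^{(\alpha,\beta)}$ is $$M_n^{(\alpha,\beta)}[f](x)=\sum_{k=0}^{\infty}\left(\frac{(n-\beta)^{k+\alpha+1}}{\Gamma(k+\alpha+1)}\int_0^\infty f(t)\,t^{k+\alpha}e^{-(n-\beta)t}\,dt\right)\psi_{n,k}(x),\qquad x\ge 0.$$ A function $f\in L_p([0,R])$ is regarded as a function on $[0,\infty)$ by setting $f=0$ on $(R,\infty)$ when the operator is applied to it.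
   Formalization: For some f in L_p (e.g. p=1, α=-1/2, f(t)=t^{-3/4}) the k=0 integral diverges and the operator is undefined; the formal statement takes that coefficient to be 0 for such f. All other f are covered exactly as stated. *)

theory Defs
  imports "HOL-Analysis.Analysis"
begin

definition psi :: "nat \<Rightarrow> nat \<Rightarrow> real \<Rightarrow> real" where
  "psi n k x = (real n * x) ^ k * exp (- (real n * x)) / fact k"

text \<open>
  At \<open>t = 0\<close> the factor \<open>t powr (k + \<alpha>)\<close> is 0 by convention; this null set does not
  affect the integral. If \<open>-1 < \<alpha> < 0\<close>, the integrand for \<open>k = 0\<close> need not be
  absolutely integrable for every \<open>f\<close> in \<open>L\<^sub>p\<close> when \<open>p\<close> is small; the value of the
  integral is then 0, as for every Lebesgue integral of a non-integrable function.
\<close>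

definition M_coeff :: "real \<Rightarrow> real \<Rightarrow> nat \<Rightarrow> (real \<Rightarrow> real) \<Rightarrow> nat \<Rightarrow> real" where
  "M_coeff \<alpha> \<beta> n f k =
     (real n - \<beta>) powr (real k + \<alpha> + 1) / Gamma (real k + \<alpha> + 1) *
     (LINT t:{0..}|lebesgue. f t * t powr (real k + \<alpha>) * exp (- ((real n - \<beta>) * t)))"

definition M_op :: "real \<Rightarrow> real \<Rightarrow> nat \<Rightarrow> (real \<Rightarrow> real) \<Rightarrow> real \<Rightarrow> real" where
  "M_op \<alpha> \<beta> n f x = (\<Sum>k. M_coeff \<alpha> \<beta> n f k * psi n k x)"

text \<open>
  Functions stand for their almost-everywhere classes. \<open>Lp_norm\<close> is the \<open>L\<^sub>p\<close> norm only on
  members of \<open>Lp_space\<close>.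
\<close>

definition Lp_space :: "real \<Rightarrow> real set \<Rightarrow> (real \<Rightarrow> real) set" where
  "Lp_space p S = {f. f \<in> borel_measurable (lebesgue_on S) \<and>
                      integrable (lebesgue_on S) (\<lambda>x. \<bar>f x\<bar> powr p)}"

definition Lp_norm :: "real \<Rightarrow> real set \<Rightarrow> (real \<Rightarrow> real) \<Rightarrow> real" where
  "Lp_norm p S f = (integral\<^sup>L (lebesgue_on S) (\<lambda>x. \<bar>f x\<bar> powr p)) powr (1 / p)"

definition zero_ext :: "real \<Rightarrow> (real \<Rightarrow> real) \<Rightarrow> real \<Rightarrow> real" where
  "zero_ext R f t = (if t \<in> {0..R} then f t else 0)"

end

theory Submission
  imports Defs
begin

text \<open>
  The \<open>k\<close>-th coefficient integrates \<open>f\<close> against the Gamma density \<open>g\<^sub>k\<close> of shape \<open>k + \<alpha> + 1\<close> and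
  rate \<open>m = n - \<beta>\<close>. The part \<open>k \<ge> 1\<close> of the operator is a contraction on \<open>L\<^sub>p\<close>: its kernel has
  mass at most 1 in \<open>t\<close>, and mass at most \<open>m / n \<le> 1\<close> in \<open>x\<close> because \<open>\<Sum>k\<ge>1. g\<^sub>k(t) \<le> m\<close> and each
  \<open>\<psi>\<^sub>n\<^sub>,\<^sub>k\<close> has integral \<open>1 / n\<close>; Jensen's inequality does the rest. For bounded functions it converges
  at points of continuity by Chebyshev's inequality, so convergence in \<open>L\<^sub>p\<close> follows by density.
  The term \<open>k = 0\<close> is not bounded on \<open>L\<^sub>p\<close> in general, but it tends to 0 for each fixed \<open>f\<close>, also
  when its coefficient is 0 because the integral diverges.
\<close>

section \<open>Gamma densities\<close>

text \<open>For negative \<open>\<alpha>\<close> the density of index 0 blows up like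
  \<open>t powr \<alpha>\<close> at 0, and for small \<open>p\<close> it lies outside the dual of
  L_p. This forces the separation of the first term, which is then controlled for one fixed function
  instead of uniformly. The size of that term comes from the norm of \<open>psi n 0\<close>, of
  order \<open>n powr (- 1 / p)\<close>. Together with the normalisation
  \<open>m powr (\<alpha> + 1)\<close> it leaves the exponent \<open>\<alpha> + 1 - 1 / p\<close>,
  whose sign decides how the integral is estimated. Poisson weights of positive index are themselves
  Gamma densities in \<open>x\<close>, up to the factor \<open>1 / n\<close>, so one normalisation
  lemma serves both variables of the kernel. Integrals of p-th powers replace norms throughout: sums
  are handled by the crude factor \<open>2 powr p\<close> in place of Minkowski's inequality, and
  the p-th root is taken only at the end.\<close>

definition gamma_density :: "real \<Rightarrow> real \<Rightarrow> real \<Rightarrow> real" where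
  "gamma_density m a t =
     m powr (a + 1) / Gamma (a + 1) * (indicator {0..} t * (t powr a * exp (- (m * t))))"

lemma gamma_density_nonneg: "a > -1 \<Longrightarrow> gamma_density m a t \<ge> 0"
  unfolding gamma_density_def by (intro mult_nonneg_nonneg divide_nonneg_nonneg Gamma_real_nonneg) auto

lemma Gamma_plus1_pos: "(a::real) > -1 \<Longrightarrow> Gamma (a + 1) > 0"
  by (intro Gamma_real_pos) auto

lemma Gamma_plus1_neq_0:
  "(a::real) > -1 \<Longrightarrow> Gamma (a + 1) \<noteq> 0"
  "(a::real) > -1 \<Longrightarrow> Gamma (1 + a) \<noteq> 0"
  using Gamma_plus1_pos[of a] by (metis add.commute less_irrefl)+

lemma gamma_density_scale:
  assumes "m > 0"
  shows "gamma_density m a t = m * gamma_density 1 a (m * t)"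
proof (cases "t \<ge> 0")
  case True
  then show ?thesis
    using assms by (simp add: gamma_density_def powr_mult powr_add field_simps)
next
  case False
  then show ?thesis
    using assms by (simp add: gamma_density_def zero_le_mult_iff)
qed

lemma has_bochner_integral_gamma_density:
  assumes "a > -1" "m > 0"
  shows "has_bochner_integral lebesgue (gamma_density m a) 1"
proof -
  let ?G = "\<lambda>t::real. t powr (a + 1 - 1) / exp t"
  have hi: "(?G has_integral Gamma (a + 1)) {0..}"
    using assms by (intro Gamma_integral_real) auto
  then have ai: "?G absolutely_integrable_on {0..}"
    by (intro nonnegative_absolutely_integrable_1) (auto simp: integrable_on_def)
  have "(LINT t:{0..}|lebesgue. ?G t) = Gamma (a + 1)"
    using set_lebesgue_integral_eq_integral(2)[OF ai] hi by (simp add: integral_unique)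
  with ai have "has_bochner_integral lebesgue (\<lambda>t. indicator {0..} t *\<^sub>R ?G t) (Gamma (a + 1))"
    by (simp add: has_bochner_integral_iff set_integrable_def set_lebesgue_integral_def)
  then have "has_bochner_integral lebesgue (\<lambda>t. indicator {0..} t *\<^sub>R ?G t / Gamma (a + 1)) 1"
    using has_bochner_integral_divide_zero[of "Gamma (a + 1)" lebesgue
        "\<lambda>t. indicator {0..} t *\<^sub>R ?G t" "Gamma (a + 1)"]
      Gamma_plus1_pos[OF assms(1)] by simp
  then have "has_bochner_integral lebesgue (gamma_density 1 a) 1"
    by (rule has_bochner_integral_cong[THEN iffD1, rotated 3])
       (auto simp: gamma_density_def exp_minus field_simps)
  then have "has_bochner_integral lebesgue (\<lambda>t. gamma_density 1 a (0 + m * t)) (1 /\<^sub>R \<bar>m\<bar>)"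
    using assms by (subst has_bochner_integral_lebesgue_real_affine_iff[symmetric]) auto
  then have "has_bochner_integral lebesgue (\<lambda>t. m * gamma_density 1 a (m * t)) (m * (1 /\<^sub>R \<bar>m\<bar>))"
    using has_bochner_integral_mult_right[of m lebesgue "\<lambda>t. gamma_density 1 a (m * t)"] by simp
  moreover have "(\<lambda>t. m * gamma_density 1 a (m * t)) = gamma_density m a"
    using gamma_density_scale[OF assms(2)] by (intro ext) (rule sym)
  ultimately show ?thesis
    using assms by simp
qed

lemma
  assumes "a > -1" "m > 0"
  shows integrable_gamma_density: "integrable lebesgue (gamma_density m a)"
    and integral_gamma_density: "integral\<^sup>L lebesgue (gamma_density m a) = 1"
  using has_bochner_integral_gamma_density[OF assms] by (auto simp: has_bochner_integral_iff)

text \<open>The functional equation of Gamma absorbs a factor \<open>t\<close> into the shape.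
  Applied repeatedly, this reduces moments of a density to total masses of other densities.\<close>

lemma gamma_density_shift:
  assumes "a > -1" "m > 0"
  shows "t * gamma_density m a t = (a + 1) / m * gamma_density m (a + 1) t"
proof (cases "t > 0")
  case True
  have "Gamma (a + 1 + 1) = (a + 1) * Gamma (a + 1)"
    using assms by (intro Gamma_plus1) (auto elim!: nonpos_Ints_cases')
  moreover have "Gamma (a + 1) > 0"
    using assms by (intro Gamma_real_pos) auto
  ultimately show ?thesis
    using assms True by (simp add: gamma_density_def powr_add divide_simps power2_eq_square)
next
  case False
  then show ?thesis
    by (cases "t = 0") (auto simp: gamma_density_def)
qed

text \<open>In the product rule the factor \<open>a\<close> cancels against
  \<open>Gamma (a + 1) = a * Gamma a\<close>, which leaves the density of the next lower shape. The
  difference form is what makes sums over the shape telescope.\<close>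

lemma gamma_density_deriv:
  assumes "a > 0" "u > 0"
  shows "(gamma_density 1 a has_real_derivative gamma_density 1 (a - 1) u - gamma_density 1 a u) (at u)"
proof -
  let ?h = "\<lambda>u. u powr a * exp (- u) / Gamma (a + 1)"
  have Ga: "Gamma (a + 1) = a * Gamma a"
    using assms by (intro Gamma_plus1) (auto elim!: nonpos_Ints_cases')
  have "((\<lambda>u. exp (- u)) has_real_derivative - exp (- u)) (at u)"
    by (auto intro!: derivative_eq_intros)
  from DERIV_cdivide[OF DERIV_mult[OF has_real_derivative_powr[OF assms(2), of a] this], of "Gamma (a + 1)"]
  have "(?h has_real_derivative
      (a * u powr (a - 1) * exp (- u) - u powr a * exp (- u)) / Gamma (a + 1)) (at u)"
    by (simp add: mult.commute)
  also have "(a * u powr (a - 1) * exp (- u) - u powr a * exp (- u)) / Gamma (a + 1)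
      = gamma_density 1 (a - 1) u - gamma_density 1 a u"
    using assms by (simp add: gamma_density_def Ga diff_divide_distrib)
  finally show ?thesis
  proof (rule DERIV_cong_ev[THEN iffD1, rotated 3])
    show "\<forall>\<^sub>F x in nhds u. ?h x = gamma_density 1 a x"
      by (rule eventually_mono[OF eventually_nhds_in_open[of "{0<..}" u]])
         (use assms in \<open>auto simp: gamma_density_def\<close>)
  qed auto
qed

text \<open>For positive \<open>a\<close> the convention \<open>0 powr a = 0\<close> agrees with the
  limit at 0, so continuity includes the left endpoint. The fundamental theorem of calculus is
  applied on such intervals.\<close>

lemma continuous_on_gamma_density:
  assumes "a > 0"
  shows "continuous_on {0..y} (gamma_density 1 a)"
proof -
  have "continuous_on {0..y} (\<lambda>u. u powr a * exp (- u) / Gamma (a + 1))"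
    using assms Gamma_plus1_neq_0[of a]
    by (intro continuous_on_divide continuous_on_mult continuous_on_powr' continuous_on_exp
        continuous_on_minus continuous_on_id continuous_on_const) auto
  then show ?thesis
    by (rule continuous_on_cong[THEN iffD1, rotated 2]) (auto simp: gamma_density_def)
qed

text \<open>The derivatives telescope to \<open>gamma_density 1 \<alpha> - gamma_density 1 (N + \<alpha>)\<close>, and the
  first of these has total mass 1.\<close>

lemma sum_gamma_density_le_1:
  assumes "\<alpha> > -1"
  shows "(\<Sum>k<N. gamma_density 1 (real (Suc k) + \<alpha>) y) \<le> 1"
proof (cases "y \<ge> 0")
  case True
  let ?D = "\<lambda>y. \<Sum>k<N. gamma_density 1 (real (Suc k) + \<alpha>) y"
  have tel: "(\<Sum>k<N. gamma_density 1 (real k + \<alpha>) u - gamma_density 1 (real (Suc k) + \<alpha>) u)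
      = gamma_density 1 \<alpha> u - gamma_density 1 (real N + \<alpha>) u" for u
    by (subst sum_lessThan_telescope'[where f="\<lambda>k. gamma_density 1 (real k + \<alpha>) u"]) simp
  have "((\<lambda>u. gamma_density 1 \<alpha> u - gamma_density 1 (real N + \<alpha>) u)
      has_integral (?D y - ?D 0)) {0..y}"
  \<comment> \<open>For negative \<open>\<alpha>\<close> the derivative is unbounded near 0; the
    interior form asks for differentiability only inside the interval and for continuity at its
    ends.\<close>
  proof (rule fundamental_theorem_of_calculus_interior[OF True])
    show "continuous_on {0..y} ?D"
      using assms by (intro continuous_intros continuous_on_gamma_density) auto
    show "(?D has_vector_derivative gamma_density 1 \<alpha> u - gamma_density 1 (real N + \<alpha>) u) (at u)"
      if "u \<in> {0<..<y}" for u
    proof -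
      have "(gamma_density 1 (real (Suc k) + \<alpha>) has_real_derivative
          gamma_density 1 (real k + \<alpha>) u - gamma_density 1 (real (Suc k) + \<alpha>) u) (at u)" for k
        using gamma_density_deriv[of "real (Suc k) + \<alpha>" u] that assms by (simp add: algebra_simps)
      from DERIV_sum[of "{..<N}" "\<lambda>y k. gamma_density 1 (real (Suc k) + \<alpha>) y", OF this] show ?thesis
        unfolding tel has_real_derivative_iff_has_vector_derivative .
    qed
  qed
  moreover have "?D 0 = 0"
    by (simp add: gamma_density_def)
  ultimately have D: "((\<lambda>u. gamma_density 1 \<alpha> u - gamma_density 1 (real N + \<alpha>) u) has_integral ?D y) {0..y}"
    by simp
  have UN: "(gamma_density 1 \<alpha> has_integral 1) UNIV"
    using has_integral_integral_lebesgue[OF integrable_gamma_density[of \<alpha> 1]]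
      integral_gamma_density[of \<alpha> 1] assms by simp
  have "gamma_density 1 \<alpha> integrable_on {0..y}"
    using UN integrable_on_subinterval[of "gamma_density 1 \<alpha>" UNIV 0 y] by (auto simp: integrable_on_def)
  then obtain I where I: "(gamma_density 1 \<alpha> has_integral I) {0..y}"
    by auto
  have "?D y \<le> I"
    using D I by (rule has_integral_le) (use assms in \<open>auto simp: gamma_density_nonneg\<close>)
  also have "I \<le> 1"
    using I UN by (rule has_integral_subset_le[rotated]) (use assms in \<open>auto simp: gamma_density_nonneg\<close>)
  finally show ?thesis .
qed (simp add: gamma_density_def)

lemma sum_gamma_density_le:
  assumes "\<alpha> > -1" "m > 0"
  shows "(\<Sum>k<N. gamma_density m (real (Suc k) + \<alpha>) t) \<le> m"
proof -
  have "(\<Sum>k<N. gamma_density m (real (Suc k) + \<alpha>) t)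
      = m * (\<Sum>k<N. gamma_density 1 (real (Suc k) + \<alpha>) (m * t))"
    unfolding sum_distrib_left by (intro sum.cong refl gamma_density_scale assms)
  also have "\<dots> \<le> m * 1"
    using assms(2) by (intro mult_left_mono sum_gamma_density_le_1 assms) simp
  finally show ?thesis by simp
qed

section \<open>Inequalities for real powers\<close>

text \<open>Young's inequality with weights \<open>(p - 1) / p\<close> and \<open>1 / p\<close>,
  applied to \<open>c powr p\<close> and \<open>u powr p\<close>, becomes this tangent-line bound
  after multiplication by \<open>p\<close>. The cases \<open>c = 0\<close> and \<open>u = 0\<close>
  are checked directly because the weighted form is applied to positive numbers.\<close>

lemma powr_tangent_le:
  assumes "p \<ge> 1" "u \<ge> 0" "c \<ge> (0::real)"
  shows "c powr p + p * c powr (p - 1) * (u - c) \<le> u powr p"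
proof (cases "c = 0 \<or> u = 0")
  case True
  have "c powr p = c powr (p - 1) * c"
    using assms by (cases "c = 0") (auto simp: powr_diff)
  moreover have "c powr (p - 1) * c \<le> p * (c powr (p - 1) * c)"
    using assms mult_right_mono[of 1 p "c powr (p - 1) * c"] by simp
  ultimately show ?thesis
    using True assms by (auto simp: algebra_simps)
next
  case False
  with assms have uc: "u > 0" "c > 0" by auto
  have "(c powr p) powr ((p - 1) / p) * (u powr p) powr (1 / p)
      \<le> (p - 1) / p * c powr p + 1 / p * u powr p"
    using assms uc by (intro Youngs_inequality_0) (auto simp: field_simps)
  then have "c powr (p - 1) * u \<le> (p - 1) / p * c powr p + 1 / p * u powr p"
    using assms uc by (simp add: powr_powr)
  from mult_left_mono[OF this, of p] have "p * (c powr (p - 1) * u) \<le> (p - 1) * c powr p + u powr p"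
    using assms by (simp add: distrib_left)
  moreover have "c powr p = c powr (p - 1) * c"
    using uc by (simp add: powr_diff)
  moreover have "c powr p + p * c powr (p - 1) * (u - c)
      = p * (c powr (p - 1) * u) + c powr p - p * (c powr (p - 1) * c)"
    by (simp add: algebra_simps)
  ultimately show ?thesis
    by (simp add: left_diff_distrib)
qed

text \<open>Integrate the tangent line of \<open>u powr p\<close> at the mean.\<close>

lemma jensen_powr:
  fixes w u :: "'a \<Rightarrow> real"
  assumes p: "p \<ge> 1" and w: "\<And>x. w x \<ge> 0" and u: "\<And>x. u x \<ge> 0"
    and iw: "integrable M w" and w1: "integral\<^sup>L M w \<le> 1"
    and iwu: "integrable M (\<lambda>x. w x * u x)" and iwp: "integrable M (\<lambda>x. w x * u x powr p)"
  shows "(\<integral>x. w x * u x \<partial>M) powr p \<le> (\<integral>x. w x * u x powr p \<partial>M)"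
proof -
  define c where "c = (\<integral>x. w x * u x \<partial>M)"
  define W where "W = integral\<^sup>L M w"
  have c0: "c \<ge> 0"
    unfolding c_def using w u by (intro integral_nonneg_AE) auto
  let ?l = "\<lambda>x. (c powr p - p * c powr (p - 1) * c) * w x + p * c powr (p - 1) * (w x * u x)"
  have "(\<integral>x. ?l x \<partial>M) \<le> (\<integral>x. w x * u x powr p \<partial>M)"
  proof (rule integral_mono)
    show "integrable M ?l" using iw iwu by auto
    show "?l x \<le> w x * u x powr p" for x
      using mult_left_mono[OF powr_tangent_le[OF p u c0] w, of x x] by (simp add: algebra_simps)
  qed fact
  also have "(\<integral>x. ?l x \<partial>M) = (c powr p - p * c powr (p - 1) * c) * W + p * c powr (p - 1) * c"
    using iw iwu by (simp add: c_def W_def)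
  also have "\<dots> = c powr p * (W + p * (1 - W))"
    using c0 by (cases "c = 0") (auto simp: powr_diff field_simps)
  finally have "c powr p * (W + p * (1 - W)) \<le> (\<integral>x. w x * u x powr p \<partial>M)" .
  \<comment> \<open>The total mass \<open>W\<close> may fall short of 1. As
    \<open>p \<ge> 1\<close>, the factor obtained from the tangent line is still at least 1, so
    Jensen's inequality survives for sub-probability weights such as the Poisson weights without
    index 0.\<close>
  moreover have "W + p * (1 - W) \<ge> 1"
    using mult_right_mono[OF p, of "1 - W"] w1 by (simp add: W_def)
  then have "c powr p * 1 \<le> c powr p * (W + p * (1 - W))"
    by (intro mult_left_mono) auto
  ultimately show ?thesis
    by (simp add: c_def)
qed

section \<open>Poisson weights\<close>

lemma psi_measurable [measurable]: "psi n k \<in> borel_measurable borel"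
  unfolding psi_def by measurable

lemma psi_nonneg: "x \<ge> 0 \<Longrightarrow> psi n k x \<ge> 0"
  by (simp add: psi_def)

lemma psi_sums: "(\<lambda>k. psi n k x) sums 1"
proof -
  have "(\<lambda>k. (real n * x) ^ k /\<^sub>R fact k * exp (- (real n * x))) sums (exp (real n * x) * exp (- (real n * x)))"
    by (intro sums_mult2 exp_converges)
  then show ?thesis
    by (simp add: psi_def field_simps flip: exp_add)
qed

lemma psi_Suc: "real (Suc k) * psi n (Suc k) x = real n * x * psi n k x"
  by (simp add: psi_def field_simps del: of_nat_Suc)

lemma psi_sums_mean: "(\<lambda>k. real k * psi n k x) sums (real n * x)"
proof -
  have "(\<lambda>k. real (Suc k) * psi n (Suc k) x) sums (real n * x * 1)"
    unfolding psi_Suc by (intro sums_mult psi_sums)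
  then show ?thesis
    by (subst (asm) sums_Suc_iff) simp
qed

text \<open>\<open>psi_Suc\<close> trades a factor \<open>k\<close> for \<open>n * x\<close> and
  lowers the index by one, so each factorial moment reduces to the preceding one. The shift of the
  summation index is free because the term at 0 vanishes.\<close>

lemma psi_sums_factorial_moment: "(\<lambda>k. real k * (real k - 1) * psi n k x) sums ((real n * x)\<^sup>2)"
proof -
  have "(\<lambda>k. real (Suc k) * (real (Suc k) - 1) * psi n (Suc k) x) sums (real n * x * (real n * x))"
  proof -
    have "real (Suc k) * (real (Suc k) - 1) * psi n (Suc k) x = real n * x * (real k * psi n k x)" for k
    proof -
      have "real (Suc k) * (real (Suc k) - 1) * psi n (Suc k) x = real k * (real (Suc k) * psi n (Suc k) x)"
        by simp
      then show ?thesis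
        unfolding psi_Suc by (simp only: mult_ac)
    qed
    then show ?thesis
      using sums_mult[OF psi_sums_mean[of n x], of "real n * x"] by presburger
  qed
  then show ?thesis
    by (subst (asm) sums_Suc_iff) (simp add: power2_eq_square)
qed

lemma psi_le_1: "x \<ge> 0 \<Longrightarrow> psi n k x \<le> 1"
  using sum_le_suminf[OF sums_summable[OF psi_sums], of "{k}" n x] sums_unique[OF psi_sums, of n x]
  by (simp add: psi_nonneg)

lemma summable_psi_Suc: "summable (\<lambda>k. psi n (Suc k) x)"
  using sums_summable[OF psi_sums, of n x] by (simp add: summable_Suc_iff[of "\<lambda>k. psi n k x"])

lemma suminf_psi_Suc: "(\<Sum>k. psi n (Suc k) x) = 1 - exp (- (real n * x))"
  using suminf_split_head[OF sums_summable[OF psi_sums], of n x] sums_unique[OF psi_sums, of n x]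
  by (simp add: psi_def)

text \<open>This makes the integral of a Poisson weight in \<open>x\<close> a consequence of the
  normalisation of Gamma densities. Index 0 is left out because \<open>0 powr 0 = 0\<close> would
  break the identity at \<open>x = 0\<close>.\<close>

lemma psi_Suc_eq_gamma_density:
  assumes "n > 0" "x \<ge> 0"
  shows "psi n (Suc k) x = gamma_density (real n) (real (Suc k)) x / real n"
proof -
  have "Gamma (real (Suc k) + 1) = fact (Suc k)"
    using Gamma_fact[of "Suc k", where 'a = real] by (simp add: add.commute)
  moreover have "real n powr (real (Suc k) + 1) = real n ^ Suc k * real n"
    using assms by (simp add: powr_add powr_realpow power2_eq_square)
  moreover have "x powr real (Suc k) = x ^ Suc k"
    using assms by (cases "x = 0") (auto simp: powr_realpow simp del: of_nat_Suc power_Suc)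
  ultimately show ?thesis
    using assms by (simp add: psi_def gamma_density_def power_mult_distrib del: of_nat_Suc fact_Suc power_Suc)
qed

lemma psi_Suc_integral:
  fixes R :: real
  assumes "n > 0"
  shows "integrable (lebesgue_on {0..R}) (psi n (Suc k))"
    and "integral\<^sup>L (lebesgue_on {0..R}) (psi n (Suc k)) \<le> 1 / real n"
proof -
  let ?g = "\<lambda>x. gamma_density (real n) (real (Suc k)) x / real n"
  have g: "integrable lebesgue ?g" "integral\<^sup>L lebesgue ?g = 1 / real n"
    using assms integrable_gamma_density[of "real (Suc k)" "real n"]
      integral_gamma_density[of "real (Suc k)" "real n"] by auto
  have gi: "integrable lebesgue (\<lambda>x. indicator {0..R} x *\<^sub>R ?g x)"
    using g by (intro integrable_mult_indicator) auto
  have "integrable (lebesgue_on {0..R}) ?g"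
    using gi by (simp add: integrable_restrict_space)
  then show "integrable (lebesgue_on {0..R}) (psi n (Suc k))"
    by (rule Bochner_Integration.integrable_cong[THEN iffD1, rotated 2])
       (use assms in \<open>auto simp: psi_Suc_eq_gamma_density\<close>)
  have "integral\<^sup>L (lebesgue_on {0..R}) (psi n (Suc k)) = integral\<^sup>L (lebesgue_on {0..R}) ?g"
    by (intro Bochner_Integration.integral_cong) (use assms in \<open>auto simp: psi_Suc_eq_gamma_density\<close>)
  also have "\<dots> = (\<integral>x. indicator {0..R} x *\<^sub>R ?g x \<partial>lebesgue)"
    by (simp add: integral_restrict_space)
  also have "\<dots> \<le> integral\<^sup>L lebesgue ?g"
    using gi g(1) by (intro integral_mono)
      (auto simp: indicator_def gamma_density_nonneg)
  finally show "integral\<^sup>L (lebesgue_on {0..R}) (psi n (Suc k)) \<le> 1 / real n"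
    by (simp only: g(2))
qed

section \<open>Coefficients against Gamma densities of positive index\<close>

lemma density_coeff_nonneg:
  assumes "\<alpha> > -1" "\<And>t. F t \<ge> 0"
  shows "(\<integral>t. F t * gamma_density m (real (Suc k) + \<alpha>) t \<partial>lebesgue) \<ge> 0"
  using assms by (intro Bochner_Integration.integral_nonneg mult_nonneg_nonneg gamma_density_nonneg) auto

text \<open>A single term is at most the sum of nonnegative terms. Boundedness lets every integrable
  function be paired with these densities; for index 0 and negative \<open>\<alpha>\<close> it
  fails.\<close>

lemma gamma_density_Suc_le:
  assumes "\<alpha> > -1" "m > 0"
  shows "gamma_density m (real (Suc k) + \<alpha>) t \<le> m"
proof -
  have "gamma_density m (real (Suc k) + \<alpha>) t \<le> (\<Sum>k<Suc k. gamma_density m (real (Suc k) + \<alpha>) t)"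
    using assms by (intro member_le_sum) (auto intro!: gamma_density_nonneg)
  also have "\<dots> \<le> m"
    by (rule sum_gamma_density_le[OF assms])
  finally show ?thesis .
qed

lemma integrable_mult_gamma_density:
  fixes F :: "real \<Rightarrow> real"
  assumes "\<alpha> > -1" "m > 0" "integrable lebesgue F"
  shows "integrable lebesgue (\<lambda>t. F t * gamma_density m (real (Suc k) + \<alpha>) t)"
proof (rule Bochner_Integration.integrable_bound)
  show "integrable lebesgue (\<lambda>t. m * F t)"
    using assms by simp
  show "(\<lambda>t. F t * gamma_density m (real (Suc k) + \<alpha>) t) \<in> borel_measurable lebesgue"
    using assms by (intro borel_measurable_times borel_measurable_integrable integrable_gamma_density) auto
  show "AE t in lebesgue. norm (F t * gamma_density m (real (Suc k) + \<alpha>) t) \<le> norm (m * F t)"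
    using assms gamma_density_Suc_le[OF assms(1,2)] gamma_density_nonneg[of "real (Suc k) + \<alpha>" m]
    by (intro AE_I2) (auto simp: abs_mult mult.commute[of m] intro!: mult_left_mono)
qed

text \<open>Partial sums of coefficients are integrals of \<open>F\<close> against partial sums of
  densities, which never exceed \<open>m\<close>. Being increasing and bounded they converge, and no
  exchange of an infinite sum with the integral is involved.\<close>

lemma summable_density_coeff:
  fixes F :: "real \<Rightarrow> real"
  assumes \<alpha>: "\<alpha> > -1" and m: "m > 0" and F: "integrable lebesgue F" "\<And>t. F t \<ge> 0"
  shows "summable (\<lambda>k. \<integral>t. F t * gamma_density m (real (Suc k) + \<alpha>) t \<partial>lebesgue)" (is "summable ?b")
    and "(\<Sum>k. \<integral>t. F t * gamma_density m (real (Suc k) + \<alpha>) t \<partial>lebesgue) \<le> m * integral\<^sup>L lebesgue F"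
proof -
  have nn: "?b k \<ge> 0" for k
    by (intro density_coeff_nonneg \<alpha> F)
  have le: "(\<Sum>k<N. ?b k) \<le> m * integral\<^sup>L lebesgue F" for N
  proof -
    have "(\<Sum>k<N. ?b k) = (\<integral>t. (\<Sum>k<N. F t * gamma_density m (real (Suc k) + \<alpha>) t) \<partial>lebesgue)"
      by (rule Bochner_Integration.integral_sum[symmetric]) (intro integrable_mult_gamma_density \<alpha> m F)
    also have "\<dots> \<le> (\<integral>t. F t * m \<partial>lebesgue)"
    proof (intro integral_mono Bochner_Integration.integrable_sum integrable_mult_gamma_density \<alpha> m F)
      show "integrable lebesgue (\<lambda>t. F t * m)"
        using F by simp
      show "(\<Sum>k<N. F t * gamma_density m (real (Suc k) + \<alpha>) t) \<le> F t * m" for t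
        unfolding sum_distrib_left[symmetric] using F \<alpha> m
        by (intro mult_left_mono sum_gamma_density_le) auto
    qed
    finally show ?thesis by (simp add: mult.commute)
  qed
  show "summable ?b"
    by (rule summableI_nonneg_bounded[OF nn le])
  then show "suminf ?b \<le> m * integral\<^sup>L lebesgue F"
    using le by (intro suminf_le_const) auto
qed

section \<open>The part k > 0 of the operator\<close>

text \<open>The rate \<open>m\<close> is a parameter independent of \<open>n\<close>: the estimates
  for fixed \<open>n\<close> use only \<open>m > 0\<close> and, for the contraction,
  \<open>m \<le> real n\<close>.\<close>

definition tail_op :: "real \<Rightarrow> real \<Rightarrow> nat \<Rightarrow> (real \<Rightarrow> real) \<Rightarrow> real \<Rightarrow> real" where
  "tail_op \<alpha> m n F x =
     (\<Sum>k. (\<integral>t. F t * gamma_density m (real (Suc k) + \<alpha>) t \<partial>lebesgue) * psi n (Suc k) x)"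

lemma summable_tail_abs:
  fixes F :: "real \<Rightarrow> real"
  assumes \<alpha>: "\<alpha> > -1" and m: "m > 0" and F: "integrable lebesgue F" and x: "x \<ge> 0"
  shows "summable (\<lambda>k. (\<integral>t. \<bar>F t\<bar> * gamma_density m (real (Suc k) + \<alpha>) t \<partial>lebesgue) * psi n (Suc k) x)"
proof (rule summable_comparison_test')
  show "summable (\<lambda>k. \<integral>t. \<bar>F t\<bar> * gamma_density m (real (Suc k) + \<alpha>) t \<partial>lebesgue)"
    using F by (intro summable_density_coeff \<alpha> m) auto
  have "(\<integral>t. \<bar>F t\<bar> * gamma_density m (real (Suc k) + \<alpha>) t \<partial>lebesgue) \<ge> 0" for k
    by (intro density_coeff_nonneg \<alpha>) simp
  then show "norm ((\<integral>t. \<bar>F t\<bar> * gamma_density m (real (Suc k) + \<alpha>) t \<partial>lebesgue) * psi n (Suc k) x)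
      \<le> (\<integral>t. \<bar>F t\<bar> * gamma_density m (real (Suc k) + \<alpha>) t \<partial>lebesgue)" for k
    using psi_le_1[OF x] psi_nonneg[OF x] by (auto simp: abs_mult intro!: mult_left_le)
qed

lemma abs_density_coeff_le:
  assumes \<alpha>: "\<alpha> > -1"
  shows "\<bar>\<integral>t. F t * gamma_density m (real (Suc k) + \<alpha>) t \<partial>lebesgue\<bar>
    \<le> (\<integral>t. \<bar>F t\<bar> * gamma_density m (real (Suc k) + \<alpha>) t \<partial>lebesgue)"
  using integral_abs_bound[of lebesgue "\<lambda>t. F t * gamma_density m (real (Suc k) + \<alpha>) t"]
    gamma_density_nonneg[of "real (Suc k) + \<alpha>" m] \<alpha>
  by (simp add: abs_mult)

lemma summable_tail:
  fixes F :: "real \<Rightarrow> real"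
  assumes \<alpha>: "\<alpha> > -1" and m: "m > 0" and F: "integrable lebesgue F" and x: "x \<ge> 0"
  shows "summable (\<lambda>k. \<bar>(\<integral>t. F t * gamma_density m (real (Suc k) + \<alpha>) t \<partial>lebesgue) * psi n (Suc k) x\<bar>)"
    and "summable (\<lambda>k. (\<integral>t. F t * gamma_density m (real (Suc k) + \<alpha>) t \<partial>lebesgue) * psi n (Suc k) x)"
proof -
  show "summable (\<lambda>k. \<bar>(\<integral>t. F t * gamma_density m (real (Suc k) + \<alpha>) t \<partial>lebesgue) * psi n (Suc k) x\<bar>)"
    by (rule summable_comparison_test'[OF summable_tail_abs[OF assms, of n]])
       (use \<alpha> x in \<open>auto simp: abs_mult psi_nonneg intro!: mult_right_mono abs_density_coeff_le simp del: of_nat_Suc\<close>)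
  then show "summable (\<lambda>k. (\<integral>t. F t * gamma_density m (real (Suc k) + \<alpha>) t \<partial>lebesgue) * psi n (Suc k) x)"
    by (rule summable_rabs_cancel)
qed

text \<open>Reading series as integrals over counting measure lets \<open>jensen_powr\<close> serve
  for sums over \<open>k\<close> as well as for integrals over \<open>t\<close>.\<close>

lemma integral_count_space_nat_eq:
  fixes f :: "nat \<Rightarrow> real"
  assumes "summable f" "\<And>k. f k \<ge> 0"
  shows "integrable (count_space UNIV) f" and "integral\<^sup>L (count_space UNIV) f = suminf f"
proof -
  show "integrable (count_space UNIV) f"
    using assms by (simp add: integrable_count_space_nat_iff)
  then show "integral\<^sup>L (count_space UNIV) f = suminf f"
    by (rule sums_unique[OF sums_integral_count_space_nat])
qed

text \<open>Jensen's inequality is used twice: in \<open>t\<close> for each Gamma density, and in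
  \<open>k\<close> for the Poisson weights of positive index, whose total is
  \<open>1 - exp (- (real n * x))\<close>.\<close>

lemma tail_op_powr_le:
  fixes F :: "real \<Rightarrow> real"
  assumes \<alpha>: "\<alpha> > -1" and m: "m > 0" and F: "integrable lebesgue F"
    and p: "p \<ge> 1" and Fp: "integrable lebesgue (\<lambda>t. \<bar>F t\<bar> powr p)" and x: "x \<ge> 0"
  shows "\<bar>tail_op \<alpha> m n F x\<bar> powr p
    \<le> (\<Sum>k. (\<integral>t. \<bar>F t\<bar> powr p * gamma_density m (real (Suc k) + \<alpha>) t \<partial>lebesgue) * psi n (Suc k) x)"
proof -
  define w where "w k = psi n (Suc k) x" for k
  define a where "a k = (\<integral>t. \<bar>F t\<bar> * gamma_density m (real (Suc k) + \<alpha>) t \<partial>lebesgue)" for k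
  define b where "b k = (\<integral>t. \<bar>F t\<bar> powr p * gamma_density m (real (Suc k) + \<alpha>) t \<partial>lebesgue)" for k
  have w0: "w k \<ge> 0" for k
    using x by (simp add: w_def psi_nonneg)
  have a0: "a k \<ge> 0" for k
    unfolding a_def by (intro density_coeff_nonneg \<alpha>) simp
  have ab: "a k powr p \<le> b k" for k
  proof -
    have "(\<integral>t. gamma_density m (real (Suc k) + \<alpha>) t * \<bar>F t\<bar> \<partial>lebesgue) powr p
      \<le> (\<integral>t. gamma_density m (real (Suc k) + \<alpha>) t * \<bar>F t\<bar> powr p \<partial>lebesgue)"
    proof (rule jensen_powr[OF p])
      show "gamma_density m (real (Suc k) + \<alpha>) t \<ge> 0" for t
        using \<alpha> by (intro gamma_density_nonneg) simp
      show "integrable lebesgue (gamma_density m (real (Suc k) + \<alpha>))"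
        using \<alpha> m by (intro integrable_gamma_density) auto
      show "integral\<^sup>L lebesgue (gamma_density m (real (Suc k) + \<alpha>)) \<le> 1"
        using \<alpha> m by (subst integral_gamma_density) auto
      show "integrable lebesgue (\<lambda>t. gamma_density m (real (Suc k) + \<alpha>) t * \<bar>F t\<bar>)"
        using integrable_mult_gamma_density[OF \<alpha> m integrable_abs[OF F], of k] by (simp only: mult.commute)
      show "integrable lebesgue (\<lambda>t. gamma_density m (real (Suc k) + \<alpha>) t * \<bar>F t\<bar> powr p)"
        using integrable_mult_gamma_density[OF \<alpha> m Fp, of k] by (simp only: mult.commute)
    qed simp
    then show ?thesis
      by (simp add: a_def b_def mult.commute)
  qed
  have w_eq: "w = (\<lambda>k. psi n (Suc k) x)"
    by (simp add: w_def fun_eq_iff)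
  have sw: "summable w" and w1: "suminf w \<le> 1"
    unfolding w_eq using summable_psi_Suc[of n x] suminf_psi_Suc[of n x] by simp_all
  have swa: "summable (\<lambda>k. w k * a k)"
    using summable_tail_abs[OF \<alpha> m F x, of n] by (simp add: w_def a_def mult.commute)
  have swb: "summable (\<lambda>k. w k * b k)"
    using summable_tail_abs[OF \<alpha> m Fp x, of n] by (simp add: w_def b_def mult.commute)
  have swap: "summable (\<lambda>k. w k * a k powr p)"
    by (rule summable_comparison_test'[OF swb]) (use ab w0 in \<open>auto simp: abs_mult intro!: mult_left_mono\<close>)
  have wa0: "w k * a k \<ge> 0" "w k * a k powr p \<ge> 0" for k
    using w0 a0 by auto
  have "(\<integral>k. w k * a k \<partial>count_space UNIV) powr p \<le> (\<integral>k. w k * a k powr p \<partial>count_space UNIV)"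
    by (rule jensen_powr[OF p w0 a0])
       (simp_all add: integral_count_space_nat_eq sw swa swap w0 wa0 w1)
  then have "(\<Sum>k. w k * a k) powr p \<le> (\<Sum>k. w k * a k powr p)"
    by (simp only: integral_count_space_nat_eq swa swap wa0)
  also have "\<dots> \<le> (\<Sum>k. w k * b k)"
    using ab w0 by (intro suminf_le swap swb mult_left_mono) auto
  finally have *: "(\<Sum>k. w k * a k) powr p \<le> (\<Sum>k. w k * b k)" .
  have "\<bar>tail_op \<alpha> m n F x\<bar> \<le> (\<Sum>k. \<bar>(\<integral>t. F t * gamma_density m (real (Suc k) + \<alpha>) t \<partial>lebesgue) * w k\<bar>)"
    unfolding tail_op_def w_def by (intro summable_rabs summable_tail[OF \<alpha> m F x])
  also have "\<dots> \<le> (\<Sum>k. w k * a k)"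
  proof (intro suminf_le swa)
    show "summable (\<lambda>k. \<bar>(\<integral>t. F t * gamma_density m (real (Suc k) + \<alpha>) t \<partial>lebesgue) * w k\<bar>)"
      unfolding w_def by (intro summable_tail[OF \<alpha> m F x])
    show "\<bar>(\<integral>t. F t * gamma_density m (real (Suc k) + \<alpha>) t \<partial>lebesgue) * w k\<bar> \<le> w k * a k" for k
      using mult_left_mono[OF abs_density_coeff_le[OF \<alpha>, of F m k] w0[of k]] w0[of k]
      by (simp add: abs_mult a_def mult.commute)
  qed
  finally have "\<bar>tail_op \<alpha> m n F x\<bar> powr p \<le> (\<Sum>k. w k * a k) powr p"
    using p by (intro powr_mono2) auto
  with * show ?thesis
    by (simp add: w_def b_def mult.commute)
qed

lemma tail_op_measurable:
  "tail_op \<alpha> m n F \<in> borel_measurable (lebesgue_on S)"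
proof -
  have "psi n k \<in> borel_measurable (lebesgue_on S)" for k
    by (intro measurable_restrict_space1 measurable_completion) simp
  then show ?thesis
    unfolding tail_op_def[abs_def] by (intro borel_measurable_suminf borel_measurable_times) simp_all
qed

text \<open>The series from \<open>tail_op_powr_le\<close> is integrated term by term. It serves at
  once as the majorant that proves integrability and as the source of the estimate, with
  \<open>1 / n\<close> from the weights and \<open>m\<close> from the densities.\<close>

lemma tail_op_contraction:
  fixes F :: "real \<Rightarrow> real"
  assumes \<alpha>: "\<alpha> > -1" and m: "m > 0" "m \<le> real n" and F: "integrable lebesgue F"
    and p: "p \<ge> 1" and Fp: "integrable lebesgue (\<lambda>t. \<bar>F t\<bar> powr p)"
  shows "integrable (lebesgue_on {0..R}) (\<lambda>x. \<bar>tail_op \<alpha> m n F x\<bar> powr p)"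
    and "(\<integral>x. \<bar>tail_op \<alpha> m n F x\<bar> powr p \<partial>lebesgue_on {0..R}) \<le> (\<integral>t. \<bar>F t\<bar> powr p \<partial>lebesgue)"
proof -
  let ?L = "lebesgue_on {0..R}"
  define b where "b k = (\<integral>t. \<bar>F t\<bar> powr p * gamma_density m (real (Suc k) + \<alpha>) t \<partial>lebesgue)" for k
  define J where "J = (\<integral>t. \<bar>F t\<bar> powr p \<partial>lebesgue)"
  have n: "n > 0"
    using m by (cases n) auto
  have b0: "b k \<ge> 0" for k
    unfolding b_def by (intro density_coeff_nonneg \<alpha>) simp
  have sb: "summable b" and b1: "suminf b \<le> m * J"
    unfolding b_def J_def using summable_density_coeff[OF \<alpha> m(1) Fp] by auto
  have int: "integrable ?L (\<lambda>x. b k * psi n (Suc k) x)" for k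
    using psi_Suc_integral[OF n] by auto
  have le: "(\<integral>x. norm (b k * psi n (Suc k) x) \<partial>?L) \<le> b k * (1 / real n)" for k
  proof -
    have "(\<integral>x. norm (b k * psi n (Suc k) x) \<partial>?L) = (\<integral>x. b k * psi n (Suc k) x \<partial>?L)"
      by (intro Bochner_Integration.integral_cong) (auto simp: b0 psi_nonneg)
    also have "\<dots> \<le> b k * (1 / real n)"
      using psi_Suc_integral[OF n, of R k] b0[of k] by (simp only: integral_mult_right_zero mult_left_mono)
    finally show ?thesis .
  qed
  have sn: "summable (\<lambda>k. \<integral>x. norm (b k * psi n (Suc k) x) \<partial>?L)"
  proof (rule summable_comparison_test')
    show "summable (\<lambda>k. b k * (1 / real n))"
      by (rule summable_mult2[OF sb])
    show "norm (\<integral>x. norm (b k * psi n (Suc k) x) \<partial>?L) \<le> b k * (1 / real n)" for k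
      using le[of k] by simp
  qed
  have AEs: "AE x in ?L. summable (\<lambda>k. norm (b k * psi n (Suc k) x))"
  proof (rule AE_I2)
    fix x assume "x \<in> space ?L"
    then have x: "x \<ge> 0"
      by simp
    have "summable (\<lambda>k. b k * psi n (Suc k) x)"
      unfolding b_def using summable_tail_abs[OF \<alpha> m(1) Fp x, of n] by simp
    then show "summable (\<lambda>k. norm (b k * psi n (Suc k) x))"
      by (simp add: b0 psi_nonneg[OF x])
  qed
  have iB: "integrable ?L (\<lambda>x. \<Sum>k. b k * psi n (Suc k) x)"
    by (rule integrable_suminf[OF int AEs sn])
  have "(\<integral>x. (\<Sum>k. b k * psi n (Suc k) x) \<partial>?L) = (\<Sum>k. \<integral>x. b k * psi n (Suc k) x \<partial>?L)"
    by (rule integral_suminf[OF int AEs sn])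
  also have "\<dots> \<le> (\<Sum>k. b k * (1 / real n))"
  proof (rule suminf_le)
    show "(\<integral>x. b k * psi n (Suc k) x \<partial>?L) \<le> b k * (1 / real n)" for k
      using psi_Suc_integral[OF n, of R k] b0[of k] by (simp only: integral_mult_right_zero mult_left_mono)
    show "summable (\<lambda>k. \<integral>x. b k * psi n (Suc k) x \<partial>?L)"
      by (rule summable_integral[OF int AEs sn])
    show "summable (\<lambda>k. b k * (1 / real n))"
      by (intro summable_mult2 sb)
  qed
  also have "\<dots> = suminf b * (1 / real n)"
    by (rule suminf_mult2[OF sb, symmetric])
  also have "\<dots> \<le> m * J * (1 / real n)"
    by (intro mult_right_mono b1) auto
  also have "\<dots> = (m / real n) * J"
    by simp
  also have "\<dots> \<le> 1 * J"
    using m n by (intro mult_right_mono) (auto simp: J_def intro!: integral_nonneg_AE)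
  finally have IB: "(\<integral>x. (\<Sum>k. b k * psi n (Suc k) x) \<partial>?L) \<le> J"
    by simp
  have pw: "\<bar>tail_op \<alpha> m n F x\<bar> powr p \<le> (\<Sum>k. b k * psi n (Suc k) x)" if "x \<in> {0..R}" for x
    unfolding b_def using that by (intro tail_op_powr_le[OF \<alpha> m(1) F p Fp]) auto
  show iT: "integrable ?L (\<lambda>x. \<bar>tail_op \<alpha> m n F x\<bar> powr p)"
  proof (rule Bochner_Integration.integrable_bound[OF iB])
    show "(\<lambda>x. \<bar>tail_op \<alpha> m n F x\<bar> powr p) \<in> borel_measurable ?L"
      using tail_op_measurable[of \<alpha> m n F "{0..R}"] by measurable
    show "AE x in ?L. norm (\<bar>tail_op \<alpha> m n F x\<bar> powr p) \<le> norm (\<Sum>k. b k * psi n (Suc k) x)"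
      using order_trans[OF pw abs_ge_self] by (intro AE_I2) simp
  qed
  have "(\<integral>x. \<bar>tail_op \<alpha> m n F x\<bar> powr p \<partial>?L) \<le> (\<integral>x. (\<Sum>k. b k * psi n (Suc k) x) \<partial>?L)"
    using iT iB pw by (intro integral_mono) auto
  with IB show "(\<integral>x. \<bar>tail_op \<alpha> m n F x\<bar> powr p \<partial>?L) \<le> (\<integral>t. \<bar>F t\<bar> powr p \<partial>lebesgue)"
    by (simp add: J_def)
qed

section \<open>Second moments and pointwise convergence\<close>

lemma gamma_density_second_moment:
  fixes x :: real
  assumes "a > -1" "m > 0"
  shows "has_bochner_integral lebesgue (\<lambda>t. (t - x)\<^sup>2 * gamma_density m a t)
    ((a + 1) * (a + 2) / m\<^sup>2 - 2 * x * (a + 1) / m + x\<^sup>2)"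
proof -
  let ?g = "gamma_density m"
  \<comment> \<open>After expansion of the square every factor \<open>t\<close> is moved into the
    shape, so each summand is a multiple of a density with mass 1.\<close>
  have eq: "(t - x)\<^sup>2 * ?g a t
      = (a + 1) * (a + 2) / m\<^sup>2 * ?g (a + 2) t - 2 * x * (a + 1) / m * ?g (a + 1) t + x\<^sup>2 * ?g a t" for t
  proof -
    have 1: "t * ?g a t = (a + 1) / m * ?g (a + 1) t"
      by (rule gamma_density_shift[OF assms])
    have 2: "t * ?g (a + 1) t = (a + 2) / m * ?g (a + 2) t"
      using gamma_density_shift[of "a + 1" m t] assms by (simp add: add.assoc)
    have "(t - x)\<^sup>2 * ?g a t = t * (t * ?g a t) - 2 * x * (t * ?g a t) + x\<^sup>2 * ?g a t"
      by (simp add: power2_eq_square algebra_simps)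
    also have "t * (t * ?g a t) = (a + 1) / m * (t * ?g (a + 1) t)"
      by (simp only: 1) (simp only: mult_ac)
    also have "\<dots> = (a + 1) * (a + 2) / m\<^sup>2 * ?g (a + 2) t"
      by (simp only: 2) (simp add: power2_eq_square)
    finally show ?thesis
      by (simp only: 1) simp
  qed
  have "has_bochner_integral lebesgue
      (\<lambda>t. (a + 1) * (a + 2) / m\<^sup>2 * ?g (a + 2) t - 2 * x * (a + 1) / m * ?g (a + 1) t + x\<^sup>2 * ?g a t)
      ((a + 1) * (a + 2) / m\<^sup>2 * 1 - 2 * x * (a + 1) / m * 1 + x\<^sup>2 * 1)"
    using assms by (intro has_bochner_integral_add has_bochner_integral_diff has_bochner_integral_mult_right
        has_bochner_integral_gamma_density) auto
  then show ?thesis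
    by (simp only: eq mult_1_right)
qed

text \<open>The exact mean of \<open>(t - x)\<^sup>2\<close> under the Poisson mixture of Gamma
  densities over all indices, including 0. The coefficient \<open>2 * \<alpha> + 4\<close> arises by
  writing \<open>(k + \<alpha> + 1) * (k + \<alpha> + 2)\<close> through the factorial moments
  \<open>k * (k - 1)\<close> and \<open>k\<close>.\<close>

definition var_bound :: "real \<Rightarrow> real \<Rightarrow> nat \<Rightarrow> real \<Rightarrow> real" where
  "var_bound \<alpha> m n x =
     ((real n * x)\<^sup>2 + (2 * \<alpha> + 4) * (real n * x) + (\<alpha> + 1) * (\<alpha> + 2)) / m\<^sup>2
     - 2 * x * (real n * x + (\<alpha> + 1)) / m + x\<^sup>2"

lemma var_bound_sums:
  "(\<lambda>k. ((real k + \<alpha> + 1) * (real k + \<alpha> + 2) / m\<^sup>2 - 2 * x * (real k + \<alpha> + 1) / m + x\<^sup>2) * psi n k x)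
     sums var_bound \<alpha> m n x"
proof -
  have "(\<lambda>k. (real k * (real k - 1) * psi n k x + (2 * \<alpha> + 4) * (real k * psi n k x)
        + (\<alpha> + 1) * (\<alpha> + 2) * psi n k x) / m\<^sup>2
      - 2 * x / m * (real k * psi n k x + (\<alpha> + 1) * psi n k x) + x\<^sup>2 * psi n k x) sums
     (((real n * x)\<^sup>2 + (2 * \<alpha> + 4) * (real n * x) + (\<alpha> + 1) * (\<alpha> + 2) * 1) / m\<^sup>2
      - 2 * x / m * (real n * x + (\<alpha> + 1) * 1) + x\<^sup>2 * 1)"
    by (intro sums_add sums_diff sums_mult sums_divide psi_sums psi_sums_mean psi_sums_factorial_moment)
  moreover have "(real k * (real k - 1) * psi n k x + (2 * \<alpha> + 4) * (real k * psi n k x)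
        + (\<alpha> + 1) * (\<alpha> + 2) * psi n k x) / m\<^sup>2
      - 2 * x / m * (real k * psi n k x + (\<alpha> + 1) * psi n k x) + x\<^sup>2 * psi n k x
    = ((real k + \<alpha> + 1) * (real k + \<alpha> + 2) / m\<^sup>2 - 2 * x * (real k + \<alpha> + 1) / m + x\<^sup>2) * psi n k x" for k
  proof -
    have "real k * (real k - 1) * psi n k x + (2 * \<alpha> + 4) * (real k * psi n k x)
        + (\<alpha> + 1) * (\<alpha> + 2) * psi n k x = (real k + \<alpha> + 1) * (real k + \<alpha> + 2) * psi n k x"
      by (simp add: algebra_simps)
    moreover have "2 * x / m * (real k * psi n k x + (\<alpha> + 1) * psi n k x)
        = 2 * x * (real k + \<alpha> + 1) / m * psi n k x"
      by (simp add: algebra_simps add_divide_distrib)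
    ultimately show ?thesis
      by (simp only: left_diff_distrib distrib_right times_divide_eq_left)
  qed
  ultimately show ?thesis
    unfolding var_bound_def by simp
qed

text \<open>The quantity is a polynomial in \<open>n / (n - \<beta>)\<close>, which tends to 1, and
  \<open>1 / (n - \<beta>)\<close>, which tends to 0. What survives in the limit is
  \<open>x\<^sup>2 - 2 * x\<^sup>2 + x\<^sup>2\<close>.\<close>

lemma var_bound_tendsto_0:
  "(\<lambda>n. var_bound \<alpha> (real n - \<beta>) n x) \<longlonglongrightarrow> 0"
proof -
  have i: "(\<lambda>n. inverse (real n)) \<longlonglongrightarrow> 0"
    by (rule LIMSEQ_inverse_real_of_nat[THEN LIMSEQ_imp_Suc]) 
  have "(\<lambda>n. 1 / (1 - \<beta> * inverse (real n))) \<longlonglongrightarrow> 1 / (1 - \<beta> * 0)"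
    by (intro tendsto_intros i) auto
  moreover have "eventually (\<lambda>n. 1 / (1 - \<beta> * inverse (real n)) = real n / (real n - \<beta>)) sequentially"
    using eventually_gt_at_top[of 0] by eventually_elim (auto simp: field_simps)
  ultimately have q: "(\<lambda>n. real n / (real n - \<beta>)) \<longlonglongrightarrow> 1"
    by (auto intro: Lim_transform_eventually)
  have "(\<lambda>n. inverse (real n) * (real n / (real n - \<beta>))) \<longlonglongrightarrow> 0 * 1"
    by (intro tendsto_intros i q)
  moreover have "eventually (\<lambda>n. inverse (real n) * (real n / (real n - \<beta>)) = 1 / (real n - \<beta>)) sequentially"
    using eventually_gt_at_top[of 0] by eventually_elim (auto simp: field_simps)
  ultimately have r: "(\<lambda>n. 1 / (real n - \<beta>)) \<longlonglongrightarrow> 0"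
    by (auto intro: Lim_transform_eventually)
  let ?q = "\<lambda>n. real n / (real n - \<beta>)" and ?r = "\<lambda>n. 1 / (real n - \<beta>)"
  have "(\<lambda>n. (x * ?q n)\<^sup>2 + (2 * \<alpha> + 4) * x * (?q n * ?r n) + (\<alpha> + 1) * (\<alpha> + 2) * (?r n)\<^sup>2
      - 2 * x * (x * ?q n + (\<alpha> + 1) * ?r n) + x\<^sup>2) \<longlonglongrightarrow>
     (x * 1)\<^sup>2 + (2 * \<alpha> + 4) * x * (1 * 0) + (\<alpha> + 1) * (\<alpha> + 2) * 0\<^sup>2 - 2 * x * (x * 1 + (\<alpha> + 1) * 0) + x\<^sup>2"
    by (intro tendsto_intros q r)
  moreover have "(x * ?q n)\<^sup>2 + (2 * \<alpha> + 4) * x * (?q n * ?r n) + (\<alpha> + 1) * (\<alpha> + 2) * (?r n)\<^sup>2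
      - 2 * x * (x * ?q n + (\<alpha> + 1) * ?r n) + x\<^sup>2 = var_bound \<alpha> (real n - \<beta>) n x" for n
    unfolding var_bound_def
    by (simp add: power_divide add_divide_distrib power2_eq_square distrib_left mult_ac)
  ultimately show ?thesis
    by (simp add: power2_eq_square)
qed

text \<open>Chebyshev's argument: at distance at least \<open>\<delta>\<close> from \<open>x\<close>
  the values differ by at most \<open>2 * B\<close>, hence by at most
  \<open>2 * B * (t - x)\<^sup>2 / \<delta>\<^sup>2\<close>. The last summand pays for the missing
  Poisson weight of index 0.\<close>

lemma tail_op_pointwise_error:
  assumes \<alpha>: "\<alpha> > -1" and m: "m > 0" and x: "x \<ge> 0"
    and h: "integrable lebesgue h" and B: "\<And>t. \<bar>h t\<bar> \<le> B"
    and \<epsilon>: "\<epsilon> \<ge> 0" and \<delta>: "\<delta> > 0" and cont: "\<And>t. \<bar>t - x\<bar> < \<delta> \<Longrightarrow> \<bar>h t - h x\<bar> \<le> \<epsilon>"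
  shows "\<bar>tail_op \<alpha> m n h x - h x\<bar>
    \<le> \<epsilon> + 2 * B / \<delta>\<^sup>2 * var_bound \<alpha> m n x + B * exp (- (real n * x))"
proof -
  define V where "V k = (real k + \<alpha> + 1) * (real k + \<alpha> + 2) / m\<^sup>2 - 2 * x * (real k + \<alpha> + 1) / m + x\<^sup>2" for k
  define C where "C = 2 * B / \<delta>\<^sup>2"
  define e where "e k = \<epsilon> + C * V k" for k
  define c where "c k = (\<integral>t. h t * gamma_density m (real (Suc k) + \<alpha>) t \<partial>lebesgue)" for k
  have B0: "B \<ge> 0"
    using B[of 0] by linarith
  have C0: "C \<ge> 0"
    using B0 by (simp add: C_def)
  have hd: "\<bar>h t - h x\<bar> \<le> \<epsilon> + C * (t - x)\<^sup>2" for t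
  proof (cases "\<bar>t - x\<bar> < \<delta>")
    case True
    then show ?thesis
      using cont[of t] C0 by (smt (verit) mult_nonneg_nonneg zero_le_power2)
  next
    case False
    then have "\<delta>\<^sup>2 \<le> (t - x)\<^sup>2"
      using \<delta> power_mono[of \<delta> "\<bar>t - x\<bar>" 2] by simp
    then have "2 * B * 1 \<le> 2 * B * ((t - x)\<^sup>2 / \<delta>\<^sup>2)"
      using B0 \<delta> by (intro mult_left_mono) (auto simp: field_simps)
    also have "\<dots> = C * (t - x)\<^sup>2"
      by (simp add: C_def)
    finally show ?thesis
      using B[of t] B[of x] \<epsilon> by linarith
  qed
  have V: "has_bochner_integral lebesgue (\<lambda>t. (t - x)\<^sup>2 * gamma_density m (real k + \<alpha>) t) (V k)" for k
    unfolding V_def using \<alpha> m by (intro gamma_density_second_moment) auto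
  have V0: "V k \<ge> 0" for k
  proof -
    have "0 \<le> (\<integral>t. (t - x)\<^sup>2 * gamma_density m (real k + \<alpha>) t \<partial>lebesgue)"
      using \<alpha> by (intro Bochner_Integration.integral_nonneg mult_nonneg_nonneg gamma_density_nonneg) auto
    then show ?thesis
      using V[of k] by (simp add: has_bochner_integral_iff)
  qed
  have ce: "\<bar>c k - h x\<bar> \<le> e (Suc k)" for k
  proof -
    let ?g = "gamma_density m (real (Suc k) + \<alpha>)"
    have g: "has_bochner_integral lebesgue ?g 1" and g0: "\<And>t. ?g t \<ge> 0"
      using \<alpha> m by (auto intro!: has_bochner_integral_gamma_density gamma_density_nonneg)
    have "has_bochner_integral lebesgue (\<lambda>t. h t * ?g t) (c k)"
      unfolding c_def using integrable_mult_gamma_density[OF \<alpha> m h] by (simp add: has_bochner_integral_iff)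
    then have "has_bochner_integral lebesgue (\<lambda>t. h t * ?g t - h x * ?g t) (c k - h x * 1)"
      by (intro has_bochner_integral_diff has_bochner_integral_mult_right g) auto
    then have d: "has_bochner_integral lebesgue (\<lambda>t. (h t - h x) * ?g t) (c k - h x)"
      by (simp add: left_diff_distrib)
    have "has_bochner_integral lebesgue (\<lambda>t. \<epsilon> * ?g t + C * ((t - x)\<^sup>2 * ?g t)) (\<epsilon> * 1 + C * V (Suc k))"
      by (intro has_bochner_integral_add has_bochner_integral_mult_right g V)
    then have E: "has_bochner_integral lebesgue (\<lambda>t. (\<epsilon> + C * (t - x)\<^sup>2) * ?g t) (e (Suc k))"
      by (simp add: e_def distrib_right mult.assoc)
    have "\<bar>c k - h x\<bar> \<le> (\<integral>t. \<bar>(h t - h x) * ?g t\<bar> \<partial>lebesgue)"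
      using d integral_abs_bound[of lebesgue "\<lambda>t. (h t - h x) * ?g t"] by (simp only: has_bochner_integral_iff)
    also have "\<dots> \<le> (\<integral>t. (\<epsilon> + C * (t - x)\<^sup>2) * ?g t \<partial>lebesgue)"
    proof (rule integral_mono)
      show "integrable lebesgue (\<lambda>t. \<bar>(h t - h x) * ?g t\<bar>)"
        using d by (intro integrable_abs) (simp only: has_bochner_integral_iff)
      show "integrable lebesgue (\<lambda>t. (\<epsilon> + C * (t - x)\<^sup>2) * ?g t)"
        using E by (simp only: has_bochner_integral_iff)
      show "\<bar>(h t - h x) * ?g t\<bar> \<le> (\<epsilon> + C * (t - x)\<^sup>2) * ?g t" for t
        using mult_right_mono[OF hd[of t] g0[of t]] g0[of t] by (simp only: abs_mult abs_of_nonneg)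
    qed
    also have "\<dots> = e (Suc k)"
      using E by (simp only: has_bochner_integral_iff)
    finally show ?thesis .
  qed
  have "(\<lambda>k. \<epsilon> * psi n k x + C * (V k * psi n k x)) sums (\<epsilon> * 1 + C * var_bound \<alpha> m n x)"
    unfolding V_def by (intro sums_add sums_mult psi_sums var_bound_sums)
  then have es: "(\<lambda>k. e k * psi n k x) sums (\<epsilon> + C * var_bound \<alpha> m n x)"
    by (simp add: e_def distrib_right mult.assoc)
  have e0: "e k \<ge> 0" for k
    unfolding e_def using \<epsilon> C0 V0 by auto
  have se: "summable (\<lambda>k. e (Suc k) * psi n (Suc k) x)"
    using sums_summable[OF es] by (simp only: summable_Suc_iff[of "\<lambda>k. e k * psi n k x"])
  have "(\<Sum>k. e (Suc k) * psi n (Suc k) x) = \<epsilon> + C * var_bound \<alpha> m n x - e 0 * psi n 0 x"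
    using suminf_split_head[OF sums_summable[OF es]] sums_unique[OF es] by simp
  also have "\<dots> \<le> \<epsilon> + C * var_bound \<alpha> m n x"
    using e0[of 0] psi_nonneg[OF x, of n 0] by simp
  finally have se_le: "(\<Sum>k. e (Suc k) * psi n (Suc k) x) \<le> \<epsilon> + C * var_bound \<alpha> m n x" .
  have sd: "summable (\<lambda>k. \<bar>(c k - h x) * psi n (Suc k) x\<bar>)"
    by (rule summable_comparison_test'[OF se])
       (use ce psi_nonneg[OF x] in \<open>auto simp: abs_mult intro!: mult_right_mono\<close>)
  have sc: "summable (\<lambda>k. c k * psi n (Suc k) x)"
    unfolding c_def by (rule summable_tail(2)[OF \<alpha> m h x])
  have "tail_op \<alpha> m n h x - h x * (1 - exp (- (real n * x)))
      = (\<Sum>k. c k * psi n (Suc k) x) - (\<Sum>k. h x * psi n (Suc k) x)"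
    by (simp only: tail_op_def c_def suminf_psi_Suc[symmetric] suminf_mult[OF summable_psi_Suc])
  also have "\<dots> = (\<Sum>k. (c k - h x) * psi n (Suc k) x)"
    using sc summable_mult[OF summable_psi_Suc[of n x], of "h x"]
    by (simp only: suminf_diff left_diff_distrib)
  finally have eq: "tail_op \<alpha> m n h x - h x * (1 - exp (- (real n * x))) = (\<Sum>k. (c k - h x) * psi n (Suc k) x)" .
  have "\<bar>\<Sum>k. (c k - h x) * psi n (Suc k) x\<bar> \<le> (\<Sum>k. \<bar>(c k - h x) * psi n (Suc k) x\<bar>)"
    by (rule summable_rabs[OF sd])
  also have "\<dots> \<le> (\<Sum>k. e (Suc k) * psi n (Suc k) x)"
    by (rule suminf_le[OF _ sd se])
       (use ce psi_nonneg[OF x] in \<open>auto simp: abs_mult intro!: mult_right_mono\<close>)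
  finally have 1: "\<bar>tail_op \<alpha> m n h x - h x * (1 - exp (- (real n * x)))\<bar> \<le> \<epsilon> + C * var_bound \<alpha> m n x"
    using se_le eq by linarith
  have 2: "\<bar>h x * exp (- (real n * x))\<bar> \<le> B * exp (- (real n * x))"
    using B[of x] by (simp add: abs_mult)
  have "tail_op \<alpha> m n h x - h x
      = (tail_op \<alpha> m n h x - h x * (1 - exp (- (real n * x)))) - h x * exp (- (real n * x))"
    by (simp add: algebra_simps)
  then show ?thesis
    using 1 2 unfolding C_def by linarith
qed

text \<open>Positivity of \<open>x\<close> makes the weight of index 0 decay. At
  \<open>x = 0\<close> all weights of positive index vanish, so the value there is 0 for every
  \<open>n\<close>.\<close>

lemma tail_op_tendsto:
  assumes \<alpha>: "\<alpha> > -1" and x: "x > 0"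
    and h: "integrable lebesgue h" and B: "\<And>t. \<bar>h t\<bar> \<le> B" and cont: "isCont h x"
  shows "(\<lambda>n. tail_op \<alpha> (real n - \<beta>) n h x) \<longlonglongrightarrow> h x"
proof (rule tendstoI)
  fix \<epsilon> :: real
  assume \<epsilon>: "\<epsilon> > 0"
  from cont \<epsilon> obtain \<delta> where \<delta>: "\<delta> > 0" "\<And>t. \<bar>t - x\<bar> < \<delta> \<Longrightarrow> \<bar>h t - h x\<bar> < \<epsilon> / 2"
    unfolding continuous_at_real_range by (metis half_gt_zero real_norm_def)
  have "(\<lambda>n. exp (- (real n * x))) \<longlonglongrightarrow> 0"
    using x by real_asymp
  then have "(\<lambda>n. \<epsilon> / 2 + 2 * B / \<delta>\<^sup>2 * var_bound \<alpha> (real n - \<beta>) n x + B * exp (- (real n * x)))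
      \<longlonglongrightarrow> \<epsilon> / 2 + 2 * B / \<delta>\<^sup>2 * 0 + B * 0"
    by (intro tendsto_intros var_bound_tendsto_0)
  then have "\<forall>\<^sub>F n in sequentially. \<epsilon> / 2 + 2 * B / \<delta>\<^sup>2 * var_bound \<alpha> (real n - \<beta>) n x + B * exp (- (real n * x)) < \<epsilon>"
    by (rule order_tendstoD(2)) (use \<epsilon> in simp)
  moreover have "\<forall>\<^sub>F n in sequentially. real n > \<beta>"
    using filterlim_real_sequentially by (simp add: filterlim_at_top_dense)
  ultimately show "\<forall>\<^sub>F n in sequentially. dist (tail_op \<alpha> (real n - \<beta>) n h x) (h x) < \<epsilon>"
  proof eventually_elim
    case (elim n)
    have "\<bar>tail_op \<alpha> (real n - \<beta>) n h x - h x\<bar>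
      \<le> \<epsilon> / 2 + 2 * B / \<delta>\<^sup>2 * var_bound \<alpha> (real n - \<beta>) n x + B * exp (- (real n * x))"
      using \<delta> \<epsilon> elim x by (intro tail_op_pointwise_error \<alpha> h B) (auto intro: less_imp_le)
    with elim show ?case
      by (simp add: dist_real_def)
  qed
qed

section \<open>Approximation by bounded continuous functions\<close>

text \<open>A substitute for Minkowski's inequality that comes from bounding both summands by the
  larger one. The constant is harmless because only finitely many errors tending to 0 are ever
  added.\<close>

lemma powr_add_le:
  fixes a b :: real
  assumes "p \<ge> 0"
  shows "\<bar>a + b\<bar> powr p \<le> 2 powr p * (\<bar>a\<bar> powr p + \<bar>b\<bar> powr p)"
proof -
  have "\<bar>a + b\<bar> powr p \<le> (2 * max \<bar>a\<bar> \<bar>b\<bar>) powr p"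
    using assms by (intro powr_mono2) auto
  also have "\<dots> = 2 powr p * max \<bar>a\<bar> \<bar>b\<bar> powr p"
    by (intro powr_mult)
  also have "\<dots> \<le> 2 powr p * (\<bar>a\<bar> powr p + \<bar>b\<bar> powr p)"
    by (intro mult_left_mono) (auto simp: max_def)
  finally show ?thesis .
qed

lemma powr_integral_add:
  fixes a b :: "'a \<Rightarrow> real"
  assumes p: "p \<ge> 0" and a: "a \<in> borel_measurable M" and b: "b \<in> borel_measurable M"
    and ia: "integrable M (\<lambda>x. \<bar>a x\<bar> powr p)" and ib: "integrable M (\<lambda>x. \<bar>b x\<bar> powr p)"
  shows "integrable M (\<lambda>x. \<bar>a x + b x\<bar> powr p)"
    and "(\<integral>x. \<bar>a x + b x\<bar> powr p \<partial>M)
      \<le> 2 powr p * ((\<integral>x. \<bar>a x\<bar> powr p \<partial>M) + (\<integral>x. \<bar>b x\<bar> powr p \<partial>M))"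
proof -
  have i: "integrable M (\<lambda>x. 2 powr p * (\<bar>a x\<bar> powr p + \<bar>b x\<bar> powr p))"
    using ia ib by auto
  show 1: "integrable M (\<lambda>x. \<bar>a x + b x\<bar> powr p)"
  proof (rule Bochner_Integration.integrable_bound[OF i])
    show "(\<lambda>x. \<bar>a x + b x\<bar> powr p) \<in> borel_measurable M"
      using a b by measurable
    show "AE x in M. norm (\<bar>a x + b x\<bar> powr p) \<le> norm (2 powr p * (\<bar>a x\<bar> powr p + \<bar>b x\<bar> powr p))"
      using order_trans[OF powr_add_le[OF p] abs_ge_self] by (intro AE_I2) simp
  qed
  have "(\<integral>x. \<bar>a x + b x\<bar> powr p \<partial>M) \<le> (\<integral>x. 2 powr p * (\<bar>a x\<bar> powr p + \<bar>b x\<bar> powr p) \<partial>M)"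
    by (intro integral_mono 1 i powr_add_le p)
  also have "\<dots> = 2 powr p * ((\<integral>x. \<bar>a x\<bar> powr p \<partial>M) + (\<integral>x. \<bar>b x\<bar> powr p \<partial>M))"
    using ia ib by simp
  finally show "(\<integral>x. \<bar>a x + b x\<bar> powr p \<partial>M)
      \<le> 2 powr p * ((\<integral>x. \<bar>a x\<bar> powr p \<partial>M) + (\<integral>x. \<bar>b x\<bar> powr p \<partial>M))" .
qed

lemma integrable_bounded_interval:
  fixes h :: "real \<Rightarrow> real"
  assumes "h \<in> borel_measurable (lebesgue_on {a..b})" "\<And>x. \<bar>h x\<bar> \<le> B"
  shows "integrable (lebesgue_on {a..b}) h"
proof (rule Bochner_Integration.integrable_bound)
  have "integrable lebesgue (\<lambda>x. indicator {a..b} x *\<^sub>R B)"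
    by (intro integrable_scaleR_left integrable_real_indicator) (auto simp: emeasure_lborel_Icc_eq)
  then show "integrable (lebesgue_on {a..b}) (\<lambda>x. B)"
    by (simp add: integrable_restrict_space)
  show "AE x in lebesgue_on {a..b}. norm (h x) \<le> norm B"
    using order_trans[OF assms(2) abs_ge_self] by (intro AE_I2) simp
qed fact

text \<open>Truncation by \<open>min\<close> and \<open>max\<close> is continuous, so the same map
  can be applied to the given function and to its continuous approximants.\<close>

definition clamp_real :: "real \<Rightarrow> real \<Rightarrow> real" where
  "clamp_real N y = max (- N) (min N y)"

lemma continuous_clamp_real: "continuous_on UNIV g \<Longrightarrow> continuous_on UNIV (\<lambda>x. clamp_real N (g x))"
  unfolding clamp_real_def by (intro continuous_intros)

lemma clamp_real_measurable [measurable]: "clamp_real N \<in> borel_measurable borel"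
  unfolding clamp_real_def by measurable

lemma powr_tendsto_0:
  fixes u :: "nat \<Rightarrow> real"
  assumes "p > 0" "u \<longlonglongrightarrow> 0"
  shows "(\<lambda>n. \<bar>u n\<bar> powr p) \<longlonglongrightarrow> 0"
proof -
  have "(\<lambda>n. \<bar>u n\<bar> powr p) \<longlonglongrightarrow> \<bar>0\<bar> powr p"
    using assms by (intro tendsto_powr' tendsto_intros) auto
  then show ?thesis by simp
qed

text \<open>At each point the error is 0 from some \<open>N\<close> on, and
  \<open>\<bar>f x\<bar> powr p\<close> dominates it.\<close>

lemma Lp_truncation_tendsto:
  fixes f :: "'a \<Rightarrow> real"
  assumes p: "p \<ge> 1" and f: "f \<in> borel_measurable M" and fp: "integrable M (\<lambda>x. \<bar>f x\<bar> powr p)"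
  shows "(\<lambda>N::nat. \<integral>x. \<bar>f x - clamp_real (real N) (f x)\<bar> powr p \<partial>M) \<longlonglongrightarrow> 0"
proof -
  have "(\<lambda>N::nat. \<integral>x. \<bar>f x - clamp_real (real N) (f x)\<bar> powr p \<partial>M) \<longlonglongrightarrow> (\<integral>x. 0 \<partial>M)"
  proof (rule integral_dominated_convergence)
    show "(\<lambda>x. \<bar>f x - clamp_real (real N) (f x)\<bar> powr p) \<in> borel_measurable M" for N
      using f by measurable
    show "AE x in M. (\<lambda>N. \<bar>f x - clamp_real (real N) (f x)\<bar> powr p) \<longlonglongrightarrow> 0"
    proof (rule AE_I2)
      fix x
      obtain N0 where N0: "real N0 \<ge> \<bar>f x\<bar>"
        using real_arch_simple by blast
      have "\<forall>\<^sub>F N in sequentially. 0 = \<bar>f x - clamp_real (real N) (f x)\<bar> powr p"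
        using eventually_ge_at_top[of N0]
      proof eventually_elim
        case (elim N)
        then have "real N \<ge> \<bar>f x\<bar>" using N0 by linarith
        then have "clamp_real (real N) (f x) = f x"
          by (auto simp: clamp_real_def)
        then show ?case by simp
      qed
      then show "(\<lambda>N. \<bar>f x - clamp_real (real N) (f x)\<bar> powr p) \<longlonglongrightarrow> 0"
        by (rule Lim_transform_eventually[OF tendsto_const])
    qed
    show "AE x in M. norm (\<bar>f x - clamp_real (real N) (f x)\<bar> powr p) \<le> \<bar>f x\<bar> powr p" for N
      using p by (intro AE_I2) (auto simp: clamp_real_def intro!: powr_mono2)
  qed (use fp in auto)
  then show ?thesis by simp
qed

text \<open>Lebesgue measurable functions are almost everywhere limits of continuous functions, so after
  truncation dominated convergence yields the approximation.\<close>

lemma Lp_continuous_approx: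
  fixes f :: "real \<Rightarrow> real"
  assumes p: "p \<ge> 1" and f: "f \<in> borel_measurable (lebesgue_on {0..R})"
    and fp: "integrable (lebesgue_on {0..R}) (\<lambda>x. \<bar>f x\<bar> powr p)" and \<epsilon>: "\<epsilon> > 0"
  obtains g B where "continuous_on UNIV g" "\<And>x. \<bar>g x\<bar> \<le> B"
    "(\<integral>x. \<bar>f x - g x\<bar> powr p \<partial>lebesgue_on {0..R}) < \<epsilon>"
proof -
  let ?L = "lebesgue_on {0..R}"
  \<comment> \<open>Two errors, truncation and approximation, are each multiplied by
    \<open>2 powr p\<close>.\<close>
  define \<epsilon>' where "\<epsilon>' = \<epsilon> / (2 * 2 powr p)"
  have \<epsilon>': "\<epsilon>' > 0" using \<epsilon> by (simp add: \<epsilon>'_def)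
  obtain N :: nat where N: "(\<integral>x. \<bar>f x - clamp_real (real N) (f x)\<bar> powr p \<partial>?L) < \<epsilon>'"
    using order_tendstoD(2)[OF Lp_truncation_tendsto[OF p f fp] \<epsilon>'] by (auto simp: eventually_sequentially)
  have "f measurable_on {0..R}"
    using f by (simp add: measurable_on_iff_borel_measurable)
  then obtain Z g where Z: "negligible Z" and g: "\<And>n. continuous_on UNIV (g n)"
    and lim: "\<And>x. x \<notin> Z \<Longrightarrow> (\<lambda>n. g n x) \<longlonglongrightarrow> (if x \<in> {0..R} then f x else 0)"
    unfolding measurable_on_def by blast
  have gm: "g n \<in> borel_measurable ?L" for n
    by (intro measurable_restrict_space1 measurable_completion)
       (use borel_measurable_continuous_onI[OF g] in simp)
  \<comment> \<open>The functions \<open>g n\<close> come without a common bound. Truncating both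
    sides at the same level gives the majorant \<open>2 * N\<close>, which suffices on a bounded
    interval.\<close>
  let ?d = "\<lambda>n x. clamp_real (real N) (f x) - clamp_real (real N) (g n x)"
  have dm: "?d n \<in> borel_measurable ?L" for n
    using gm f by measurable
  have db: "\<bar>?d n x\<bar> \<le> 2 * real N" for n x
    by (auto simp: clamp_real_def)
  have dpm: "(\<lambda>x. \<bar>?d n x\<bar> powr p) \<in> borel_measurable ?L" for n
    using dm by measurable
  have dpb: "\<bar>\<bar>?d n x\<bar> powr p\<bar> \<le> (2 * real N) powr p" for n x
    using p db[of x n] by (auto intro!: powr_mono2)
  have "(\<lambda>n. \<integral>x. \<bar>?d n x\<bar> powr p \<partial>?L) \<longlonglongrightarrow> (\<integral>x. 0 \<partial>?L)"
  proof (rule integral_dominated_convergence)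
    have "AE x in lebesgue. x \<notin> Z"
      using Z by (intro AE_not_in) (simp add: negligible_iff_null_sets)
    then have "AE x in ?L. x \<notin> Z"
      by (subst AE_restrict_space_iff) auto
    moreover have "AE x in ?L. x \<in> {0..R}"
      by (intro AE_I2) simp
    ultimately show "AE x in ?L. (\<lambda>n. \<bar>?d n x\<bar> powr p) \<longlonglongrightarrow> 0"
    proof eventually_elim
      case (elim x)
      then have "(\<lambda>n. g n x) \<longlonglongrightarrow> f x"
        using lim[of x] by simp
      then have "(\<lambda>n. ?d n x) \<longlonglongrightarrow> clamp_real (real N) (f x) - clamp_real (real N) (f x)"
        unfolding clamp_real_def by (intro tendsto_intros)
      then show ?case
        using p by (intro powr_tendsto_0) auto
    qed
    show "integrable ?L (\<lambda>x. (2 * real N) powr p)"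
      by (rule integrable_bounded_interval[where B = "(2 * real N) powr p"]) auto
    show "AE x in ?L. norm (\<bar>?d n x\<bar> powr p) \<le> (2 * real N) powr p" for n
      using dpb by (intro AE_I2) simp
  qed (use dpm in auto)
  then have "(\<lambda>n. \<integral>x. \<bar>?d n x\<bar> powr p \<partial>?L) \<longlonglongrightarrow> 0"
    by simp
  from order_tendstoD(2)[OF this \<epsilon>'] obtain n where n: "(\<integral>x. \<bar>?d n x\<bar> powr p \<partial>?L) < \<epsilon>'"
    unfolding eventually_sequentially by blast
  let ?h = "\<lambda>x. clamp_real (real N) (g n x)"
  have e1: "(\<lambda>x. f x - clamp_real (real N) (f x)) \<in> borel_measurable ?L"
    using f by measurable
  have "integrable ?L (\<lambda>x. \<bar>f x - clamp_real (real N) (f x)\<bar> powr p)"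
  proof (rule Bochner_Integration.integrable_bound[OF fp])
    show "(\<lambda>x. \<bar>f x - clamp_real (real N) (f x)\<bar> powr p) \<in> borel_measurable ?L"
      using e1 by measurable
    show "AE x in ?L. norm (\<bar>f x - clamp_real (real N) (f x)\<bar> powr p) \<le> norm (\<bar>f x\<bar> powr p)"
      using p by (intro AE_I2) (auto simp: clamp_real_def intro!: powr_mono2)
  qed
  moreover have "integrable ?L (\<lambda>x. \<bar>?d n x\<bar> powr p)"
    by (rule integrable_bounded_interval[OF dpm dpb])
  ultimately have "(\<integral>x. \<bar>(f x - clamp_real (real N) (f x)) + ?d n x\<bar> powr p \<partial>?L)
    \<le> 2 powr p * ((\<integral>x. \<bar>f x - clamp_real (real N) (f x)\<bar> powr p \<partial>?L) + (\<integral>x. \<bar>?d n x\<bar> powr p \<partial>?L))"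
    using p by (intro powr_integral_add(2) e1 dm) auto
  also have "\<dots> < 2 powr p * (\<epsilon>' + \<epsilon>')"
    using N n by (intro mult_strict_left_mono) auto
  also have "\<dots> = \<epsilon>"
    by (simp add: \<epsilon>'_def)
  finally have lt: "(\<integral>x. \<bar>f x - ?h x\<bar> powr p \<partial>?L) < \<epsilon>"
    by simp
  show thesis
    by (rule that[OF continuous_clamp_real[OF g[of n], of "real N"], of "real N"]) (use lt in \<open>auto simp: clamp_real_def\<close>)
qed

section \<open>The term k = 0\<close>

lemma filterlim_shift_at_top: "filterlim (\<lambda>n. real n - \<beta>) at_top sequentially"
  using filterlim_tendsto_add_at_top[OF tendsto_const[of "- \<beta>"] filterlim_real_sequentially] by simp

lemma eventually_shift_pos: "\<forall>\<^sub>F n in sequentially. real n - \<beta> > 0"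
  using filterlim_shift_at_top[of \<beta>] unfolding filterlim_at_top_dense by blast

text \<open>Dominated convergence with majorant \<open>\<bar>G t\<bar>\<close>. The factor
  \<open>c\<close> is 1 when the exponential is kept whole and \<open>p / 2\<close> when half of it
  is raised to the power \<open>p\<close>.\<close>

lemma integral_exp_decay:
  fixes G :: "real \<Rightarrow> real"
  assumes G: "integrable lebesgue G" and neg: "\<And>t. t < 0 \<Longrightarrow> G t = 0" and c: "c > 0"
  shows "(\<lambda>n. \<integral>t. G t * exp (- (c * (real n - \<beta>) * t)) \<partial>lebesgue) \<longlonglongrightarrow> 0"
proof -
  let ?m = "\<lambda>n. c * (real n - \<beta>)"
  have m: "filterlim ?m at_top sequentially"
    by (rule filterlim_tendsto_pos_mult_at_top[OF tendsto_const c filterlim_shift_at_top])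
  then have ev: "\<forall>\<^sub>F n in sequentially. ?m n \<ge> 0"
    by (simp add: filterlim_at_top)
  \<comment> \<open>For the finitely many \<open>n\<close> below \<open>\<beta>\<close> the
    exponential exceeds 1 on positive \<open>t\<close>; setting these members to 0 keeps the
    majorant valid for every \<open>n\<close>.\<close>
  define s where "s n t = (if ?m n \<ge> 0 then G t * exp (- (?m n * t)) else 0)" for n t
  have "(\<lambda>n. \<integral>t. s n t \<partial>lebesgue) \<longlonglongrightarrow> integral\<^sup>L lebesgue (\<lambda>t::real. 0)"
  proof (rule integral_dominated_convergence)
    have "(\<lambda>t. exp (- (b * t))) \<in> borel_measurable lebesgue" for b :: real
      by (intro measurable_completion) simp
    from borel_measurable_times[OF borel_measurable_integrable[OF G] this]
    show "s n \<in> borel_measurable lebesgue" for n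
      unfolding s_def by auto
    \<comment> \<open>At \<open>t = 0\<close> the exponential is constantly 1, so this point is
      discarded as a null set.\<close>
    have "AE t in lebesgue. t \<notin> {0::real}"
      by (intro AE_not_in) (simp add: negligible_iff_null_sets[symmetric])
    then show "AE t in lebesgue. (\<lambda>n. s n t) \<longlonglongrightarrow> 0"
    proof eventually_elim
      case (elim t)
      show ?case
      proof (cases "t > 0")
        case True
        have "filterlim (\<lambda>n. t * ?m n) at_top sequentially"
          by (rule filterlim_tendsto_pos_mult_at_top[OF tendsto_const True m])
        then have "(\<lambda>n. exp (- (t * ?m n))) \<longlonglongrightarrow> 0"
          by (intro filterlim_compose[OF exp_at_bot] filterlim_compose[OF filterlim_uminus_at_bot_at_top])
        from tendsto_mult[OF tendsto_const[of "G t"] this]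
        have "(\<lambda>n. G t * exp (- (?m n * t))) \<longlonglongrightarrow> 0"
          by (simp add: mult_ac)
        moreover have "\<forall>\<^sub>F n in sequentially. G t * exp (- (?m n * t)) = s n t"
          using ev by eventually_elim (simp add: s_def)
        ultimately show ?thesis
          by (rule Lim_transform_eventually)
      next
        case False
        then have "s n t = 0" for n
          using neg[of t] elim by (simp add: s_def)
        then show ?thesis by simp
      qed
    qed
    show "integrable lebesgue (\<lambda>t. \<bar>G t\<bar>)"
      using G by (rule integrable_abs)
    show "AE t in lebesgue. norm (s n t) \<le> \<bar>G t\<bar>" for n
    proof (rule AE_I2)
      fix t
      show "norm (s n t) \<le> \<bar>G t\<bar>"
      proof (cases "t \<ge> 0 \<and> ?m n \<ge> 0")
        case True
        then have "exp (- (?m n * t)) \<le> 1" by simp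
        then have "\<bar>G t\<bar> * exp (- (?m n * t)) \<le> \<bar>G t\<bar>"
          by (intro mult_left_le) auto
        then show ?thesis
          using True by (simp add: s_def abs_mult)
      next
        case False
        then have "s n t = 0"
          using neg[of t] by (auto simp: s_def)
        then show ?thesis by simp
      qed
    qed
  qed auto
  then have "(\<lambda>n. \<integral>t. s n t \<partial>lebesgue) \<longlonglongrightarrow> 0" by simp
  moreover have "\<forall>\<^sub>F n in sequentially.
      (\<integral>t. s n t \<partial>lebesgue) = (\<integral>t. G t * exp (- (?m n * t)) \<partial>lebesgue)"
    using ev by eventually_elim (simp add: s_def)
  ultimately show ?thesis
    by (rule Lim_transform_eventually)
qed

text \<open>The two cases of the \<open>k = 0\<close> coefficient: when \<open>\<alpha> + 1 \<le> 1/p\<close> the normalising power of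
  \<open>m\<close> is bounded and dominated convergence applies (the integral being 0 by convention if it
  diverges); otherwise \<open>t powr \<alpha>\<close> is locally in the dual space and Young's inequality applies.\<close>

lemma head_coeff_tendsto_integrable:
  fixes F :: "real \<Rightarrow> real"
  assumes \<gamma>: "\<gamma> \<le> 0" and F: "F \<in> borel_measurable lebesgue" and supp: "\<And>t. t \<notin> {0..R} \<Longrightarrow> F t = 0"
  shows "(\<lambda>n. (real n - \<beta>) powr \<gamma> * \<bar>\<integral>t. F t * (t powr \<alpha> * exp (- ((real n - \<beta>) * t))) \<partial>lebesgue\<bar>) \<longlonglongrightarrow> 0"
proof -
  let ?G = "\<lambda>t. F t * t powr \<alpha>"
  let ?m = "\<lambda>n. real n - \<beta>"
  let ?I = "\<lambda>n. \<integral>t. F t * (t powr \<alpha> * exp (- (?m n * t))) \<partial>lebesgue"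
  have ev1: "\<forall>\<^sub>F n in sequentially. ?m n \<ge> 1"
    using filterlim_shift_at_top[of \<beta>] by (simp add: filterlim_at_top)
  have Gm: "?G \<in> borel_measurable lebesgue"
    using F by (intro borel_measurable_times) (auto intro!: measurable_completion)
  have eq: "F t * (t powr \<alpha> * exp (- (c * t))) = ?G t * exp (- (c * t))" for t c
    by simp
  have I0: "?I \<longlonglongrightarrow> 0"
  proof (cases "integrable lebesgue ?G")
    case True
    then show ?thesis
      using integral_exp_decay[of ?G 1 \<beta>] supp by (simp add: mult.assoc)
  next
    case False
    have "?I n = 0" if "?m n \<ge> 1" for n
    proof -
      \<comment> \<open>On \<open>[0, R]\<close> the exponential lies between
        \<open>exp (- (m * R))\<close> and 1, where \<open>m\<close> is the rate, so it cannot
        repair a divergent integral. The integral then has the default value 0.\<close>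
      have "\<not> integrable lebesgue (\<lambda>t. ?G t * exp (- (?m n * t)))"
      proof
        assume "integrable lebesgue (\<lambda>t. ?G t * exp (- (?m n * t)))"
        then have i: "integrable lebesgue (\<lambda>t. exp (?m n * R) * (?G t * exp (- (?m n * t))))"
          by (rule integrable_mult_right)
        have "integrable lebesgue ?G"
        proof (rule Bochner_Integration.integrable_bound[OF i Gm], rule AE_I2)
          fix t
          show "norm (?G t) \<le> norm (exp (?m n * R) * (?G t * exp (- (?m n * t))))"
          proof (cases "t \<in> {0..R}")
            case True
            then have "?m n * t \<le> ?m n * R"
              using that by (intro mult_left_mono) auto
            then have "1 \<le> exp (?m n * R) * exp (- (?m n * t))"
              by (simp flip: exp_add)
            then have "\<bar>?G t\<bar> * 1 \<le> \<bar>?G t\<bar> * (exp (?m n * R) * exp (- (?m n * t)))"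
              by (intro mult_left_mono) auto
            then show ?thesis
              by (simp add: abs_mult mult_ac)
          next
            case False
            then show ?thesis using supp by simp
          qed
        qed
        with False show False by simp
      qed
      then show ?thesis
        by (simp only: eq) (rule not_integrable_integral_eq)
    qed
    then have "\<forall>\<^sub>F n in sequentially. 0 = ?I n"
      using ev1 by (auto elim: eventually_mono)
    then show ?thesis
      by (rule Lim_transform_eventually[OF tendsto_const])
  qed
  show ?thesis
  proof (rule Lim_null_comparison)
    show "\<forall>\<^sub>F n in sequentially. norm (?m n powr \<gamma> * \<bar>?I n\<bar>) \<le> \<bar>?I n\<bar>"
      using ev1
    proof eventually_elim
      case (elim n)
      then have "?m n powr \<gamma> \<le> 1"
        using powr_mono[of \<gamma> 0 "?m n"] \<gamma> by simp
      then show ?case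
        by (simp add: abs_mult mult_left_le_one_le)
    qed
    show "(\<lambda>n. \<bar>?I n\<bar>) \<longlonglongrightarrow> 0"
      using tendsto_rabs[OF I0] by simp
  qed
qed

lemma head_coeff_tendsto_young:
  fixes F :: "real \<Rightarrow> real"
  assumes p: "p > 1" and \<gamma>: "\<gamma> = \<alpha> + 1 - 1 / p" "\<gamma> > 0"
    and Fp: "integrable lebesgue (\<lambda>t. \<bar>F t\<bar> powr p)" and supp: "\<And>t. t < 0 \<Longrightarrow> F t = 0"
  shows "(\<lambda>n. (real n - \<beta>) powr \<gamma> * \<bar>\<integral>t. F t * (t powr \<alpha> * exp (- ((real n - \<beta>) * t))) \<partial>lebesgue\<bar>) \<longlonglongrightarrow> 0"
proof -
  \<comment> \<open>The conjugate exponent. The relation \<open>\<gamma> * q = s + 1\<close> turns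
    positivity of \<open>\<gamma>\<close> into \<open>s > -1\<close>, which is integrability of
    \<open>t powr s\<close> at 0.\<close>
  define q where "q = p / (p - 1)"
  define s where "s = \<alpha> * q"
  \<comment> \<open>Chosen so that
    \<open>m powr (s + 1) * t powr s * exp (- (q * m / 2 * t))\<close> equals \<open>K\<close> times
    the Gamma density of rate \<open>q * m / 2\<close> for positive \<open>t\<close>. Its integral
    therefore does not depend on \<open>m\<close>.\<close>
  define K where "K = Gamma (s + 1) * (2 / q) powr (s + 1)"
  have q: "q > 1" "1 / p + 1 / q = 1"
    using p by (auto simp: q_def field_simps)
  have "q / p = q - 1"
    using p by (simp add: q_def field_simps)
  then have \<gamma>q: "\<gamma> * q = s + 1"
    by (simp add: \<gamma> s_def algebra_simps)
  then have s: "s > -1"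
    using mult_pos_pos[OF \<gamma>(2), of q] q by simp
  have K: "K \<ge> 0"
    unfolding K_def using s q by (intro mult_nonneg_nonneg Gamma_real_nonneg) auto
  let ?A = "\<lambda>n. \<integral>t. \<bar>F t\<bar> powr p * exp (- (p / 2 * (real n - \<beta>) * t)) \<partial>lebesgue"
  let ?I = "\<lambda>m. \<integral>t. F t * (t powr \<alpha> * exp (- (m * t))) \<partial>lebesgue"
  \<comment> \<open>The exponential is split into two equal halves. One stays with \<open>F\<close>
    and yields the decay as \<open>m\<close> grows; the other makes \<open>t powr \<alpha>\<close>
    integrable to the power \<open>q\<close>. The free weight \<open>\<eta>\<close> shifts the
    balance: it is taken large first, and then \<open>n\<close> tends to infinity.\<close>
  have key: "m powr \<gamma> * \<bar>?I m\<bar>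
      \<le> \<eta> powr p * (\<integral>t. \<bar>F t\<bar> powr p * exp (- (p / 2 * m * t)) \<partial>lebesgue) + K / \<eta> powr q"
    if m: "m > 0" and \<eta>: "\<eta> > 0" for m \<eta>
  proof -
    define M where "M = q * m / 2"
    have M: "M > 0" using m q by (simp add: M_def)
    let ?E = "\<lambda>t. exp (- (p / 2 * m * t))"
    let ?r = "\<lambda>t. \<eta> powr p * (\<bar>F t\<bar> powr p * ?E t) + K / \<eta> powr q * gamma_density M s t"
    have iE: "integrable lebesgue (\<lambda>t. \<bar>F t\<bar> powr p * ?E t)"
    proof (rule Bochner_Integration.integrable_bound[OF Fp])
      have "?E \<in> borel_measurable lebesgue"
        by (intro measurable_completion) simp
      with Fp show "(\<lambda>t. \<bar>F t\<bar> powr p * ?E t) \<in> borel_measurable lebesgue"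
        by (intro borel_measurable_times) auto
      show "AE t in lebesgue. norm (\<bar>F t\<bar> powr p * ?E t) \<le> norm (\<bar>F t\<bar> powr p)"
      proof (rule AE_I2)
        fix t
        show "norm (\<bar>F t\<bar> powr p * ?E t) \<le> norm (\<bar>F t\<bar> powr p)"
          using supp[of t] m p by (cases "t < 0") (auto simp: abs_mult intro!: mult_left_le)
      qed
    qed
    have ir: "integrable lebesgue ?r"
      using iE integrable_gamma_density[OF s M] by auto
    have r0: "?r t \<ge> 0" for t
      using K gamma_density_nonneg[OF s] by auto
    have pw: "m powr \<gamma> * \<bar>F t * (t powr \<alpha> * exp (- (m * t)))\<bar> \<le> ?r t" for t
    proof (cases "t > 0")
      case True
      define a where "a = \<eta> * (\<bar>F t\<bar> * exp (- (m / 2 * t)))"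
      define b where "b = m powr \<gamma> / \<eta> * (t powr \<alpha> * exp (- (m / 2 * t)))"
      have ab0: "a \<ge> 0" "b \<ge> 0"
        using \<eta> by (auto simp: a_def b_def)
      have "exp (- (m / 2 * t)) * exp (- (m / 2 * t)) = exp (- (m * t))"
        by (simp flip: exp_add)
      then have "m powr \<gamma> * \<bar>F t * (t powr \<alpha> * exp (- (m * t)))\<bar> = a * b"
        using \<eta> by (simp add: a_def b_def abs_mult mult_ac)
      also have "\<dots> \<le> a powr p / p + b powr q / q"
        by (intro Youngs_inequality p q ab0)
      also have "\<dots> \<le> a powr p + b powr q"
        using p q by (intro add_mono) (auto simp: divide_le_eq mult_left_le_one_le intro!: mult_le_cancel_left1[THEN iffD2])
      also have "a powr p = \<eta> powr p * (\<bar>F t\<bar> powr p * ?E t)"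
        by (simp add: a_def powr_mult exp_powr_real mult_ac)
      also have "b powr q = K / \<eta> powr q * gamma_density M s t"
      proof -
        have 1: "b powr q = m powr (s + 1) / \<eta> powr q * (t powr s * exp (- (M * t)))"
          by (simp add: b_def powr_mult powr_divide powr_powr \<gamma>q s_def M_def exp_powr_real mult_ac)
        have 2: "K * (M powr (s + 1) / Gamma (s + 1)) = m powr (s + 1)"
        proof -
          have "(2 / q) powr (s + 1) * M powr (s + 1) = (2 / q * M) powr (s + 1)"
            by (rule powr_mult[symmetric])
          also have "2 / q * M = m"
            using q by (simp add: M_def)
          finally show ?thesis
            using Gamma_plus1_pos[OF s] by (simp add: K_def)
        qed
        show ?thesis
          using True unfolding 1 2[symmetric] gamma_density_def by (simp add: mult_ac)
      qed
      finally show ?thesis .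
    next
      case False
      then have z: "F t * (t powr \<alpha> * exp (- (m * t))) = 0"
        using supp[of t] by (cases "t = 0") auto
      show ?thesis
        unfolding z using r0[of t] by simp
    qed
    have "m powr \<gamma> * \<bar>?I m\<bar> \<le> m powr \<gamma> * (\<integral>t. \<bar>F t * (t powr \<alpha> * exp (- (m * t)))\<bar> \<partial>lebesgue)"
      by (intro mult_left_mono integral_abs_bound) auto
    also have "\<dots> = (\<integral>t. m powr \<gamma> * \<bar>F t * (t powr \<alpha> * exp (- (m * t)))\<bar> \<partial>lebesgue)"
      by simp
    also have "\<dots> \<le> (\<integral>t. ?r t \<partial>lebesgue)"
      by (rule integral_mono'[OF ir pw r0])
    also have "\<dots> = \<eta> powr p * (\<integral>t. \<bar>F t\<bar> powr p * ?E t \<partial>lebesgue) + K / \<eta> powr q * 1"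
      using iE integrable_gamma_density[OF s M] integral_gamma_density[OF s M] by simp
    finally show ?thesis by simp
  qed
  have A0: "?A \<longlonglongrightarrow> 0"
    using p supp by (intro integral_exp_decay Fp) auto
  show ?thesis
  proof (rule tendstoI)
    fix \<epsilon> :: real
    assume \<epsilon>: "\<epsilon> > 0"
    \<comment> \<open>Makes the second term \<open>\<epsilon> * K / (2 * (K + 1))\<close>; the added
      1 gives strict inequality and a positive \<open>\<eta>\<close>.\<close>
    define \<eta> where "\<eta> = (2 * (K + 1) / \<epsilon>) powr (1 / q)"
    have \<eta>: "\<eta> > 0" "\<eta> powr q = 2 * (K + 1) / \<epsilon>"
      using \<epsilon> K q by (auto simp: \<eta>_def powr_powr)
    have half: "K / \<eta> powr q < \<epsilon> / 2"
      using \<epsilon> K by (simp add: \<eta>(2) divide_simps)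
    have "(\<lambda>n. \<eta> powr p * ?A n) \<longlonglongrightarrow> \<eta> powr p * 0"
      by (intro tendsto_intros A0)
    then have "\<forall>\<^sub>F n in sequentially. \<eta> powr p * ?A n < \<epsilon> / 2"
      by (rule order_tendstoD(2)) (use \<epsilon> in simp)
    moreover have "\<forall>\<^sub>F n in sequentially. real n - \<beta> > 0"
      by (rule eventually_shift_pos)
    ultimately show "\<forall>\<^sub>F n in sequentially. dist ((real n - \<beta>) powr \<gamma> * \<bar>?I (real n - \<beta>)\<bar>) 0 < \<epsilon>"
    proof eventually_elim
      case (elim n)
      have "(real n - \<beta>) powr \<gamma> * \<bar>?I (real n - \<beta>)\<bar> < \<epsilon>"
        using key[OF elim(2) \<eta>(1)] half elim(1) by linarith
      then show ?case
        by (simp add: dist_real_def abs_mult)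
    qed
  qed
qed

text \<open>For \<open>p = 1\<close> the exponent is \<open>\<alpha>\<close>, which is not positive.
  A positive exponent therefore forces \<open>p > 1\<close>, and the conjugate exponent is
  finite.\<close>

lemma head_coeff_tendsto:
  fixes F :: "real \<Rightarrow> real"
  assumes p: "p \<ge> 1" and \<alpha>: "\<alpha> \<le> 0" and F: "F \<in> borel_measurable lebesgue"
    and Fp: "integrable lebesgue (\<lambda>t. \<bar>F t\<bar> powr p)" and supp: "\<And>t. t \<notin> {0..R} \<Longrightarrow> F t = 0"
  shows "(\<lambda>n. (real n - \<beta>) powr (\<alpha> + 1 - 1 / p)
      * \<bar>\<integral>t. F t * (t powr \<alpha> * exp (- ((real n - \<beta>) * t))) \<partial>lebesgue\<bar>) \<longlonglongrightarrow> 0"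
proof (cases "\<alpha> + 1 - 1 / p \<le> 0")
  case True
  then show ?thesis
    by (rule head_coeff_tendsto_integrable[OF _ F supp])
next
  case False
  with p \<alpha> have "p > 1"
    by (cases "p = 1") auto
  with False show ?thesis
    using supp by (intro head_coeff_tendsto_young[OF _ refl _ Fp]) auto
qed

section \<open>Coefficients as Gamma averages, and the size of the first term\<close>

lemma M_coeff_eq:
  "M_coeff \<alpha> \<beta> n F k = (\<integral>t. F t * gamma_density (real n - \<beta>) (real k + \<alpha>) t \<partial>lebesgue)"
proof -
  let ?C = "(real n - \<beta>) powr (real k + \<alpha> + 1) / Gamma (real k + \<alpha> + 1)"
  have "M_coeff \<alpha> \<beta> n F k = (\<integral>t. ?C * (indicator {0..} t *\<^sub>R
      (F t * t powr (real k + \<alpha>) * exp (- ((real n - \<beta>) * t)))) \<partial>lebesgue)"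
    unfolding M_coeff_def set_lebesgue_integral_def by (rule integral_mult_right_zero[symmetric])
  also have "\<dots> = (\<integral>t. F t * gamma_density (real n - \<beta>) (real k + \<alpha>) t \<partial>lebesgue)"
    by (simp add: gamma_density_def mult_ac)
  finally show ?thesis .
qed

lemma M_coeff_0_eq:
  assumes "\<And>t. t < 0 \<Longrightarrow> F t = 0"
  shows "M_coeff \<alpha> \<beta> n F 0 = (real n - \<beta>) powr (\<alpha> + 1) / Gamma (\<alpha> + 1)
    * (\<integral>t. F t * (t powr \<alpha> * exp (- ((real n - \<beta>) * t))) \<partial>lebesgue)"
proof -
  have "indicator {0..} t *\<^sub>R (F t * t powr \<alpha> * exp (- ((real n - \<beta>) * t)))
      = F t * (t powr \<alpha> * exp (- ((real n - \<beta>) * t)))" for t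
    using assms[of t] by (cases "t < 0") (auto simp: indicator_def)
  then show ?thesis
    unfolding M_coeff_def set_lebesgue_integral_def by (simp only: of_nat_0 add_0)
qed

text \<open>The p-th power of \<open>exp (- (n * x))\<close> is, up to a constant, the exponential
  density of rate \<open>n * p\<close>.\<close>

lemma psi_0_powr_integral:
  fixes R p :: real
  assumes p: "p > 0" and n: "n > 0"
  shows "integrable (lebesgue_on {0..R}) (\<lambda>x. \<bar>c * psi n 0 x\<bar> powr p)"
    and "(\<integral>x. \<bar>c * psi n 0 x\<bar> powr p \<partial>lebesgue_on {0..R}) \<le> \<bar>c\<bar> powr p / (real n * p)"
proof -
  let ?b = "real n * p"
  let ?g = "\<lambda>x. \<bar>c\<bar> powr p / ?b * gamma_density ?b 0 x"
  have b: "?b > 0" using p n by simp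
  have g: "integrable lebesgue ?g" "integral\<^sup>L lebesgue ?g = \<bar>c\<bar> powr p / ?b"
    using integrable_gamma_density[of 0 ?b] integral_gamma_density[of 0 ?b] b by auto
  have gi: "integrable lebesgue (\<lambda>x. indicator {0..R} x *\<^sub>R ?g x)"
    using g by (intro integrable_mult_indicator) auto
  have iL: "integrable (lebesgue_on {0..R}) ?g"
    using gi by (simp add: integrable_restrict_space)
  have eq: "\<bar>c * psi n 0 x\<bar> powr p = \<bar>c\<bar> powr p * exp (- (?b * x))" for x
    by (simp add: psi_def abs_mult powr_mult exp_powr_real mult_ac)
  have m: "(\<lambda>x. \<bar>c * psi n 0 x\<bar> powr p) \<in> borel_measurable (lebesgue_on {0..R})"
    unfolding eq by (intro measurable_restrict_space1 measurable_completion) simp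
  \<comment> \<open>At \<open>x = 0\<close> the convention \<open>0 powr 0 = 0\<close> makes the
    density vanish while the weight is 1, so the two agree only almost everywhere.\<close>
  have "AE x in lebesgue. x \<notin> {0::real}"
    by (intro AE_not_in) (simp add: negligible_iff_null_sets[symmetric])
  then have AE: "AE x in lebesgue_on {0..R}. ?g x = \<bar>c * psi n 0 x\<bar> powr p"
  proof (subst AE_restrict_space_iff)
    assume "AE x in lebesgue. x \<notin> {0::real}"
    then show "AE x in lebesgue. x \<in> {0..R} \<longrightarrow> ?g x = \<bar>c * psi n 0 x\<bar> powr p"
    proof eventually_elim
      case (elim x)
      then show ?case
        using b by (auto simp: eq gamma_density_def)
    qed
  qed auto
  show "integrable (lebesgue_on {0..R}) (\<lambda>x. \<bar>c * psi n 0 x\<bar> powr p)"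
    by (rule integrable_cong_AE_imp[OF iL m AE])
  have "(\<integral>x. \<bar>c * psi n 0 x\<bar> powr p \<partial>lebesgue_on {0..R}) = integral\<^sup>L (lebesgue_on {0..R}) ?g"
    by (rule integral_cong_AE[symmetric]) (use iL m AE in auto)
  also have "\<dots> = (\<integral>x. indicator {0..R} x *\<^sub>R ?g x \<partial>lebesgue)"
    by (rule integral_restrict_space) simp
  also have "\<dots> \<le> integral\<^sup>L lebesgue ?g"
  proof (intro integral_mono gi g(1))
    have "?g x \<ge> 0" for x
      using p by (intro mult_nonneg_nonneg divide_nonneg_nonneg gamma_density_nonneg) auto
    then show "indicator {0..R} x *\<^sub>R ?g x \<le> ?g x" for x
      unfolding real_scaleR_def by (intro mult_left_le_one_le) (auto simp: indicator_def)
  qed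
  finally show "(\<integral>x. \<bar>c * psi n 0 x\<bar> powr p \<partial>lebesgue_on {0..R}) \<le> \<bar>c\<bar> powr p / (real n * p)"
    by (simp only: g(2))
qed

text \<open>Since \<open>m \<le> real n * p\<close>, the integral of the weight contributes at most
  \<open>1 / m\<close>. Written as the p-th power of \<open>m powr (- 1 / p)\<close>, this combines
  with the normalisation \<open>m powr (\<alpha> + 1)\<close> to the exponent treated in
  \<open>head_coeff_tendsto\<close>.\<close>

lemma head_tendsto:
  fixes F :: "real \<Rightarrow> real"
  assumes p: "p \<ge> 1" and \<alpha>: "-1 < \<alpha>" "\<alpha> \<le> 0" and \<beta>: "\<beta> \<ge> 0" and F: "F \<in> borel_measurable lebesgue"
    and Fp: "integrable lebesgue (\<lambda>t. \<bar>F t\<bar> powr p)" and supp: "\<And>t. t \<notin> {0..R} \<Longrightarrow> F t = 0"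
  shows "(\<lambda>n. \<integral>x. \<bar>M_coeff \<alpha> \<beta> n F 0 * psi n 0 x\<bar> powr p \<partial>lebesgue_on {0..R}) \<longlonglongrightarrow> 0"
proof (rule Lim_null_comparison)
  let ?I = "\<lambda>n. \<integral>t. F t * (t powr \<alpha> * exp (- ((real n - \<beta>) * t))) \<partial>lebesgue"
  let ?u = "\<lambda>n. ((real n - \<beta>) powr (\<alpha> + 1 - 1 / p) * \<bar>?I n\<bar>) / Gamma (\<alpha> + 1)"
  have G: "Gamma (\<alpha> + 1) > 0"
    using \<alpha> by (intro Gamma_plus1_pos) auto
  have "?u \<longlonglongrightarrow> 0"
    using tendsto_divide[OF head_coeff_tendsto[OF p \<alpha>(2) F Fp supp] tendsto_const[of "Gamma (\<alpha> + 1)"]] G by simp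
  then show "(\<lambda>n. \<bar>?u n\<bar> powr p) \<longlonglongrightarrow> 0"
    using p by (intro powr_tendsto_0) auto
  have "\<forall>\<^sub>F n in sequentially. real n - \<beta> > 0"
    by (rule eventually_shift_pos)
  then show "\<forall>\<^sub>F n in sequentially.
      norm (\<integral>x. \<bar>M_coeff \<alpha> \<beta> n F 0 * psi n 0 x\<bar> powr p \<partial>lebesgue_on {0..R}) \<le> \<bar>?u n\<bar> powr p"
  proof eventually_elim
    case (elim n)
    define m where "m = real n - \<beta>"
    have m: "m > 0" "m \<le> real n" "n > 0"
      using elim \<beta> by (auto simp: m_def intro!: gr0I)
    let ?c = "M_coeff \<alpha> \<beta> n F 0"
    have c: "\<bar>?c\<bar> = m powr (\<alpha> + 1) * \<bar>?I n\<bar> / Gamma (\<alpha> + 1)"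
      using supp G by (subst M_coeff_0_eq) (auto simp: m_def abs_mult)
    have "(\<integral>x. \<bar>?c * psi n 0 x\<bar> powr p \<partial>lebesgue_on {0..R}) \<le> \<bar>?c\<bar> powr p / (real n * p)"
      using p m by (intro psi_0_powr_integral) auto
    also have "\<dots> \<le> \<bar>?c\<bar> powr p / m"
      using m p mult_mono[of m "real n" 1 p] by (intro divide_left_mono) auto
    also have "\<dots> = (\<bar>?c\<bar> * m powr (- 1 / p)) powr p"
    proof -
      have "(m powr (- 1 / p)) powr p = m powr (- 1)"
        using p by (simp only: powr_powr) simp
      then show ?thesis
        using m by (simp add: powr_mult powr_neg_one)
    qed
    also have "\<bar>?c\<bar> * m powr (- 1 / p) = ?u n"
    proof -
      have "m powr (\<alpha> + 1 - 1 / p) = m powr (\<alpha> + 1) * m powr (- 1 / p)"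
        by (simp flip: powr_add)
      then show ?thesis
        by (simp add: c m_def)
    qed
    also have "?u n = \<bar>?u n\<bar>"
      using G by simp
    finally show ?case
      by (simp add: integral_nonneg_AE)
  qed
qed

section \<open>Convergence\<close>

text \<open>Both averages, over \<open>t\<close> and over \<open>k\<close>, have mass at most 1. The
  bound supplies the constant majorant for dominated convergence in \<open>x\<close>.\<close>

lemma tail_op_bounded:
  assumes \<alpha>: "\<alpha> > -1" and m: "m > 0" and x: "x \<ge> 0"
    and h: "integrable lebesgue h" and B: "\<And>t. \<bar>h t\<bar> \<le> B"
  shows "\<bar>tail_op \<alpha> m n h x\<bar> \<le> B"
proof -
  let ?g = "\<lambda>k. gamma_density m (real (Suc k) + \<alpha>)"
  define c where "c k = (\<integral>t. h t * ?g k t \<partial>lebesgue)" for k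
  have B0: "B \<ge> 0"
    using B[of 0] by linarith
  have cB: "\<bar>c k\<bar> \<le> B" for k
  proof -
    have "\<bar>c k\<bar> \<le> (\<integral>t. \<bar>h t\<bar> * ?g k t \<partial>lebesgue)"
      unfolding c_def by (rule abs_density_coeff_le[OF \<alpha>])
    also have "\<dots> \<le> (\<integral>t. B * ?g k t \<partial>lebesgue)"
    proof (rule integral_mono)
      show "integrable lebesgue (\<lambda>t. \<bar>h t\<bar> * ?g k t)"
        by (intro integrable_mult_gamma_density \<alpha> m integrable_abs h)
      show "integrable lebesgue (\<lambda>t. B * ?g k t)"
        using \<alpha> m by (intro integrable_mult_right integrable_gamma_density) auto
      show "\<bar>h t\<bar> * ?g k t \<le> B * ?g k t" for t
        using \<alpha> by (intro mult_right_mono B gamma_density_nonneg) auto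
    qed
    also have "\<dots> = B"
      using \<alpha> m by (simp add: integral_gamma_density)
    finally show ?thesis .
  qed
  have s: "summable (\<lambda>k. \<bar>c k * psi n (Suc k) x\<bar>)"
    unfolding c_def by (rule summable_tail(1)[OF \<alpha> m h x])
  have "\<bar>tail_op \<alpha> m n h x\<bar> \<le> (\<Sum>k. \<bar>c k * psi n (Suc k) x\<bar>)"
    unfolding tail_op_def c_def[symmetric] by (rule summable_rabs[OF s])
  also have "\<dots> \<le> (\<Sum>k. B * psi n (Suc k) x)"
    by (rule suminf_le[OF _ s summable_mult[OF summable_psi_Suc]])
       (use cB psi_nonneg[OF x] in \<open>auto simp: abs_mult intro!: mult_right_mono\<close>)
  also have "\<dots> = B * (1 - exp (- (real n * x)))"
    by (simp only: suminf_mult[OF summable_psi_Suc] suminf_psi_Suc)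
  also have "\<dots> \<le> B"
    using B0 by (intro mult_left_le) auto
  finally show ?thesis .
qed

lemma tail_op_diff:
  assumes "\<alpha> > -1" "m > 0" "x \<ge> 0" "integrable lebesgue F" "integrable lebesgue h"
  shows "tail_op \<alpha> m n (\<lambda>t. F t - h t) x = tail_op \<alpha> m n F x - tail_op \<alpha> m n h x"
proof -
  have "(\<integral>t. (F t - h t) * gamma_density m (real (Suc k) + \<alpha>) t \<partial>lebesgue)
    = (\<integral>t. F t * gamma_density m (real (Suc k) + \<alpha>) t \<partial>lebesgue)
    - (\<integral>t. h t * gamma_density m (real (Suc k) + \<alpha>) t \<partial>lebesgue)" for k
    unfolding left_diff_distrib
    by (intro Bochner_Integration.integral_diff integrable_mult_gamma_density assms)
  then show ?thesis
    unfolding tail_op_def left_diff_distrib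
    using suminf_diff[OF summable_tail(2)[OF assms(1,2,4,3), of n] summable_tail(2)[OF assms(1,2,5,3), of n]]
    by (simp only: left_diff_distrib)
qed

text \<open>Dominated convergence on a bounded interval with majorant \<open>(2 * B) powr p\<close>.
  Continuity is asked only in the open interval, as a zero extension may jump at both ends.\<close>

lemma tail_op_Lp_tendsto:
  fixes h :: "real \<Rightarrow> real"
  assumes p: "p \<ge> 1" and \<alpha>: "\<alpha> > -1" and h: "integrable lebesgue h" and B: "\<And>t. \<bar>h t\<bar> \<le> B"
    and cont: "\<And>x. x \<in> {0<..<R} \<Longrightarrow> isCont h x"
  shows "(\<lambda>n. \<integral>x. \<bar>tail_op \<alpha> (real n - \<beta>) n h x - h x\<bar> powr p \<partial>lebesgue_on {0..R}) \<longlonglongrightarrow> 0"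
proof -
  let ?L = "lebesgue_on {0..R}"
  \<comment> \<open>The bound on \<open>tail_op\<close> requires a positive rate and
    \<open>x \<ge> 0\<close>; elsewhere the value 0 keeps the majorant valid for every
    \<open>n\<close> and \<open>x\<close>.\<close>
  define s where "s n x = (if real n - \<beta> > 0 \<and> x \<ge> 0
      then \<bar>tail_op \<alpha> (real n - \<beta>) n h x - h x\<bar> powr p else 0)" for n x
  have ev: "\<forall>\<^sub>F n in sequentially. real n - \<beta> > 0"
    by (rule eventually_shift_pos)
  have eq: "(\<integral>x. s n x \<partial>?L) = (\<integral>x. \<bar>tail_op \<alpha> (real n - \<beta>) n h x - h x\<bar> powr p \<partial>?L)"
    if "real n - \<beta> > 0" for n
    using that by (intro Bochner_Integration.integral_cong) (auto simp: s_def)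
  have hm: "h \<in> borel_measurable ?L"
    using h by (intro measurable_restrict_space1) auto
  have sm: "s n \<in> borel_measurable ?L" for n
  proof (cases "real n - \<beta> > 0")
    case True
    have "(\<lambda>x. \<bar>tail_op \<alpha> (real n - \<beta>) n h x - h x\<bar> powr p) \<in> borel_measurable ?L"
      using hm tail_op_measurable[of \<alpha> "real n - \<beta>" n h "{0..R}"] by measurable
    then show ?thesis
      by (rule measurable_cong[THEN iffD1, rotated]) (use True in \<open>auto simp: s_def\<close>)
  next
    case False
    then have "s n = (\<lambda>x. 0)"
      by (simp add: s_def fun_eq_iff)
    then show ?thesis by simp
  qed
  have "(\<lambda>n. \<integral>x. s n x \<partial>?L) \<longlonglongrightarrow> integral\<^sup>L ?L (\<lambda>x. 0)"
  proof (rule integral_dominated_convergence)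
    have "AE x in lebesgue. x \<notin> {0, R}"
      by (intro AE_not_in) (simp add: negligible_iff_null_sets[symmetric])
    then have "AE x in ?L. x \<notin> {0, R}"
      by (subst AE_restrict_space_iff) auto
    moreover have "AE x in ?L. x \<in> {0..R}"
      by (intro AE_I2) simp
    ultimately show "AE x in ?L. (\<lambda>n. s n x) \<longlonglongrightarrow> 0"
    proof eventually_elim
      case (elim x)
      then have x: "x \<in> {0<..<R}" by auto
      then have "(\<lambda>n. tail_op \<alpha> (real n - \<beta>) n h x) \<longlonglongrightarrow> h x"
        by (intro tail_op_tendsto[OF \<alpha> _ h B cont]) auto
      then have "(\<lambda>n. tail_op \<alpha> (real n - \<beta>) n h x - h x) \<longlonglongrightarrow> 0"
        by (rule LIM_zero)
      then have "(\<lambda>n. \<bar>tail_op \<alpha> (real n - \<beta>) n h x - h x\<bar> powr p) \<longlonglongrightarrow> 0"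
        using p by (intro powr_tendsto_0) auto
      moreover have "\<forall>\<^sub>F n in sequentially. \<bar>tail_op \<alpha> (real n - \<beta>) n h x - h x\<bar> powr p = s n x"
        using ev by eventually_elim (use x in \<open>simp add: s_def\<close>)
      ultimately show ?case
        by (rule Lim_transform_eventually)
    qed
    show "integrable ?L (\<lambda>x. (2 * B) powr p)"
      by (rule integrable_bounded_interval[where B = "(2 * B) powr p"]) auto
    show "AE x in ?L. norm (s n x) \<le> (2 * B) powr p" for n
    proof (rule AE_I2)
      fix x
      show "norm (s n x) \<le> (2 * B) powr p"
      proof (cases "real n - \<beta> > 0 \<and> x \<ge> 0")
        case True
        then have "\<bar>tail_op \<alpha> (real n - \<beta>) n h x\<bar> \<le> B"
          by (intro tail_op_bounded \<alpha> h B) auto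
        then have "\<bar>tail_op \<alpha> (real n - \<beta>) n h x - h x\<bar> \<le> 2 * B"
          using B[of x] by linarith
        then show ?thesis
          using True p by (auto simp: s_def intro!: powr_mono2)
      next
        case False
        then show ?thesis by (auto simp: s_def)
      qed
    qed
  qed (use sm in auto)
  then have "(\<lambda>n. \<integral>x. s n x \<partial>?L) \<longlonglongrightarrow> 0" by simp
  moreover have "\<forall>\<^sub>F n in sequentially.
      (\<integral>x. s n x \<partial>?L) = (\<integral>x. \<bar>tail_op \<alpha> (real n - \<beta>) n h x - h x\<bar> powr p \<partial>?L)"
    using ev by eventually_elim (rule eq)
  ultimately show ?thesis
    by (rule Lim_transform_eventually)
qed

section \<open>Zero extension and the transfer between the interval and the line\<close>

lemma zero_ext_indicator: "zero_ext R f t = indicator {0..R} t *\<^sub>R f t"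
  by (simp add: zero_ext_def)

lemma zero_ext_measurable:
  "f \<in> borel_measurable (lebesgue_on {0..R}) \<Longrightarrow> zero_ext R f \<in> borel_measurable lebesgue"
  by (simp add: borel_measurable_restrict_space_iff zero_ext_indicator[abs_def])

lemma zero_ext_powr: "\<bar>zero_ext R f t\<bar> powr p = indicator {0..R} t *\<^sub>R (\<bar>f t\<bar> powr p)"
  by (simp add: zero_ext_def)

lemma zero_ext_powr_integrable:
  "integrable lebesgue (\<lambda>t. \<bar>zero_ext R f t\<bar> powr p) \<longleftrightarrow> integrable (lebesgue_on {0..R}) (\<lambda>t. \<bar>f t\<bar> powr p)"
  unfolding zero_ext_powr by (simp add: integrable_restrict_space)

lemma zero_ext_powr_integral:
  "(\<integral>t. \<bar>zero_ext R f t\<bar> powr p \<partial>lebesgue) = (\<integral>t. \<bar>f t\<bar> powr p \<partial>lebesgue_on {0..R})"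
  unfolding zero_ext_powr by (simp add: integral_restrict_space)

text \<open>On an interval of finite length the bound
  \<open>\<bar>y\<bar> \<le> 1 + \<bar>y\<bar> powr p\<close> passes from p-th power integrability
  to integrability.\<close>

lemma zero_ext_integrable:
  assumes p: "p \<ge> 1" and f: "f \<in> borel_measurable (lebesgue_on {0..R})"
    and fp: "integrable (lebesgue_on {0..R}) (\<lambda>t. \<bar>f t\<bar> powr p)"
  shows "integrable lebesgue (zero_ext R f)"
proof -
  have "integrable (lebesgue_on {0..R}) f"
  proof (rule Bochner_Integration.integrable_bound[OF _ f])
    have "integrable (lebesgue_on {0..R}) (\<lambda>t. 1 :: real)"
      by (rule integrable_bounded_interval[where B = 1]) auto
    with fp show "integrable (lebesgue_on {0..R}) (\<lambda>t. 1 + \<bar>f t\<bar> powr p)"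
      by (intro Bochner_Integration.integrable_add)
    have "\<bar>y\<bar> \<le> 1 + \<bar>y\<bar> powr p" for y :: real
    proof (cases "\<bar>y\<bar> \<le> 1")
      case False
      then show ?thesis
        using powr_mono[of 1 p "\<bar>y\<bar>"] p by simp
    qed (simp add: add_increasing2)
    then show "AE t in lebesgue_on {0..R}. norm (f t) \<le> norm (1 + \<bar>f t\<bar> powr p)"
      by (intro AE_I2) simp
  qed
  then show ?thesis
    by (simp add: integrable_restrict_space zero_ext_indicator[abs_def])
qed

theorem theorem5:
  fixes p \<alpha> \<beta> R :: real and f :: "real \<Rightarrow> real"
  assumes "1 \<le> p"
    and "- 1 / 2 \<le> \<alpha>" and "\<alpha> \<le> 0"
    and "0 \<le> \<beta>"
    and "0 < R"
    and "f \<in> Lp_space p {0..R}"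
  shows "(\<forall>n::nat. real n > \<beta> \<longrightarrow>
            (\<forall>x\<ge>0. summable (\<lambda>k. M_coeff \<alpha> \<beta> n (zero_ext R f) k * psi n k x)) \<and>
            (\<lambda>x. M_op \<alpha> \<beta> n (zero_ext R f) x - f x) \<in> Lp_space p {0..R}) \<and>
         (\<lambda>n. Lp_norm p {0..R} (\<lambda>x. M_op \<alpha> \<beta> n (zero_ext R f) x - f x)) \<longlonglongrightarrow> 0"
proof -
  let ?L = "lebesgue_on {0..R}"
  define F where "F = zero_ext R f"
  define c where "c n = M_coeff \<alpha> \<beta> n F 0" for n
  note p = assms(1)
  have p0: "p \<ge> 0" "p > 0" using p by auto
  have \<alpha>: "\<alpha> > -1" "\<alpha> \<le> 0" using assms by auto
  have f: "f \<in> borel_measurable ?L" and fp: "integrable ?L (\<lambda>x. \<bar>f x\<bar> powr p)"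
    using assms by (auto simp: Lp_space_def)
  have Fm: "F \<in> borel_measurable lebesgue" and Fp: "integrable lebesgue (\<lambda>t. \<bar>F t\<bar> powr p)"
    and F: "integrable lebesgue F"
    unfolding F_def using f fp p
    by (auto intro: zero_ext_measurable zero_ext_integrable simp: zero_ext_powr_integrable)
  have supp: "F t = 0" if "t \<notin> {0..R}" for t
    using that unfolding F_def zero_ext_def by (simp only: if_False)

  have coeff: "M_coeff \<alpha> \<beta> n F (Suc k)
      = (\<integral>t. F t * gamma_density (real n - \<beta>) (real (Suc k) + \<alpha>) t \<partial>lebesgue)" for n k
    by (rule M_coeff_eq)
  have summ: "summable (\<lambda>k. M_coeff \<alpha> \<beta> n F k * psi n k x)" if "real n > \<beta>" "x \<ge> 0" for n x
  proof -
    \<comment> \<open>Only the terms of positive index matter for convergence, so a divergent first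
      integral with default value 0 does no harm.\<close>
    have "summable (\<lambda>k. M_coeff \<alpha> \<beta> n F (Suc k) * psi n (Suc k) x)"
      unfolding coeff by (rule summable_tail(2)) (use \<alpha> F that in auto)
    then show ?thesis
      by (simp only: summable_Suc_iff[of "\<lambda>k. M_coeff \<alpha> \<beta> n F k * psi n k x"])
  qed
  have M: "M_op \<alpha> \<beta> n F x = c n * psi n 0 x + tail_op \<alpha> (real n - \<beta>) n F x"
    if "real n > \<beta>" "x \<ge> 0" for n x
    using suminf_split_head[OF summ[OF that]]
    by (simp only: M_op_def tail_op_def c_def coeff)

  have headm: "(\<lambda>x. c n * psi n 0 x) \<in> borel_measurable ?L" for n
    by (intro measurable_restrict_space1 measurable_completion) simp
  note tailm = tail_op_measurable[of \<alpha> _ _ _ "{0..R}"]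
  have mn: "n > 0" "real n - \<beta> > 0" "real n - \<beta> \<le> real n" if "real n > \<beta>" for n
    using that assms(4) by (auto intro!: gr0I)
  have headi: "integrable ?L (\<lambda>x. \<bar>c n * psi n 0 x\<bar> powr p)" if "real n > \<beta>" for n
    by (rule psi_0_powr_integral(1)[OF p0(2) mn(1)[OF that]])

  have Lp: "(\<lambda>x. M_op \<alpha> \<beta> n F x - f x) \<in> Lp_space p {0..R}" if n: "real n > \<beta>" for n
  proof -
    let ?D = "\<lambda>x. c n * psi n 0 x + (tail_op \<alpha> (real n - \<beta>) n F x + - f x)"
    have fm': "(\<lambda>x. - f x) \<in> borel_measurable ?L" using f by simp
    have fp': "integrable ?L (\<lambda>x. \<bar>- f x\<bar> powr p)" using fp by simp
    note tail = tail_op_contraction(1)[OF \<alpha>(1) mn(2,3)[OF n] F p Fp, of R]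
    have D1: "?D \<in> borel_measurable ?L"
      by (intro borel_measurable_add headm tailm fm')
    have D2: "integrable ?L (\<lambda>x. \<bar>?D x\<bar> powr p)"
      by (intro powr_integral_add(1) p0(1) headm headi n tailm fm' fp' tail borel_measurable_add)
    have eq: "M_op \<alpha> \<beta> n F x - f x = ?D x" if "x \<in> space ?L" for x
      using M[OF n, of x] that by simp
    have "(\<lambda>x. M_op \<alpha> \<beta> n F x - f x) \<in> borel_measurable ?L"
      by (rule measurable_cong[THEN iffD2, OF eq D1])
    moreover have "integrable ?L (\<lambda>x. \<bar>M_op \<alpha> \<beta> n F x - f x\<bar> powr p)"
      by (rule Bochner_Integration.integrable_cong[THEN iffD2, OF refl _ D2]) (simp only: eq)
    ultimately show ?thesis
      by (simp add: Lp_space_def)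
  qed

  have lim: "(\<lambda>n. \<integral>x. \<bar>M_op \<alpha> \<beta> n F x - f x\<bar> powr p \<partial>?L) \<longlonglongrightarrow> 0"
  proof (rule tendstoI)
    fix \<epsilon> :: real
    assume \<epsilon>: "\<epsilon> > 0"
    define P where "P = (2::real) powr p"
    have P: "P \<ge> 1"
      unfolding P_def using p by (intro ge_one_powr_ge_zero) auto
    \<comment> \<open>Adding four errors by nested use of \<open>powr_integral_add\<close> gives
      them the weights \<open>P\<close>, \<open>P ^ 2\<close>, \<open>P ^ 3\<close> and
      \<open>P ^ 3\<close>, in total at most \<open>4 * P ^ 3\<close> because
      \<open>P \<ge> 1\<close>.\<close>
    define \<epsilon>' where "\<epsilon>' = \<epsilon> / (4 * P ^ 3)"
    have \<epsilon>': "\<epsilon>' > 0" using \<epsilon> P by (simp add: \<epsilon>'_def)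
    obtain g B where g: "continuous_on UNIV g" "\<And>x. \<bar>g x\<bar> \<le> B"
      and fg: "(\<integral>x. \<bar>f x - g x\<bar> powr p \<partial>?L) < \<epsilon>'"
      using Lp_continuous_approx[OF p f fp \<epsilon>'] by blast
    \<comment> \<open>Cutting off \<open>g\<close> makes \<open>F - h\<close> the zero extension of
      \<open>f - g\<close>, so the contraction estimate over the whole line involves only the
      approximation error on \<open>[0, R]\<close>.\<close>
    define h where "h = zero_ext R g"
    have gm: "g \<in> borel_measurable ?L"
      by (intro measurable_restrict_space1 measurable_completion)
         (use borel_measurable_continuous_onI[OF g(1)] in simp)
    have gpm: "(\<lambda>x. \<bar>g x\<bar> powr p) \<in> borel_measurable ?L"
      using gm by measurable
    have gp: "integrable ?L (\<lambda>x. \<bar>g x\<bar> powr p)"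
      by (rule integrable_bounded_interval[OF gpm, of "B powr p"]) (use g p in \<open>auto intro!: powr_mono2\<close>)
    have h: "integrable lebesgue h"
      unfolding h_def by (rule zero_ext_integrable[OF p gm gp])
    have hB: "\<bar>h t\<bar> \<le> B" for t
      using g(2)[of t] by (auto simp: h_def zero_ext_def)
    have hg: "h x = g x" if "x \<in> {0..R}" for x
      using that by (simp add: h_def zero_ext_def)
    have hcont: "isCont h x" if "x \<in> {0<..<R}" for x
    proof -
      have "isCont g x"
        using g(1) by (simp add: continuous_on_eq_continuous_at)
      moreover have "\<forall>\<^sub>F y in nhds x. h y = g y"
        by (rule eventually_mono[OF eventually_nhds_in_open[of "{0<..<R}"]]) (use that hg in auto)
      ultimately show ?thesis
        by (subst isCont_cong)
    qed
    have hm: "h \<in> borel_measurable ?L"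
      using h by (intro measurable_restrict_space1) auto
    have hp: "integrable ?L (\<lambda>x. \<bar>h x\<bar> powr p)"
      using gp by (rule Bochner_Integration.integrable_cong[THEN iffD1, rotated 2]) (auto simp: hg)
    have hf: "integrable ?L (\<lambda>x. \<bar>h x - f x\<bar> powr p)"
      using powr_integral_add(1)[OF p0(1) hm _ hp, of "\<lambda>x. - f x"] f fp by simp
    have hf_int: "(\<integral>x. \<bar>h x - f x\<bar> powr p \<partial>?L) = (\<integral>x. \<bar>f x - g x\<bar> powr p \<partial>?L)"
      by (intro Bochner_Integration.integral_cong) (auto simp: hg abs_minus_commute)
    have Fh: "integrable lebesgue (\<lambda>t. F t - h t)"
      using F h by simp
    have Fh_eq: "(\<lambda>t. F t - h t) = zero_ext R (\<lambda>x. f x - h x)"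
      by (auto simp: F_def h_def zero_ext_def)
    have Fhp: "integrable lebesgue (\<lambda>t. \<bar>F t - h t\<bar> powr p)"
      using hf zero_ext_powr_integrable[of R "\<lambda>x. f x - h x" p]
      by (simp add: Fh_eq[unfolded fun_eq_iff, rule_format] abs_minus_commute)
    have Fh_int: "(\<integral>t. \<bar>F t - h t\<bar> powr p \<partial>lebesgue) = (\<integral>x. \<bar>f x - g x\<bar> powr p \<partial>?L)"
      using zero_ext_powr_integral[of R "\<lambda>x. f x - h x" p] hf_int
      by (simp add: Fh_eq[unfolded fun_eq_iff, rule_format] abs_minus_commute)

    have "(\<lambda>n. \<integral>x. \<bar>c n * psi n 0 x\<bar> powr p \<partial>?L) \<longlonglongrightarrow> 0"
      unfolding c_def by (rule head_tendsto[OF p \<alpha> assms(4) Fm Fp]) (rule supp)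
    note order_tendstoD(2)[OF this \<epsilon>']
    moreover have "(\<lambda>n. \<integral>x. \<bar>tail_op \<alpha> (real n - \<beta>) n h x - h x\<bar> powr p \<partial>?L) \<longlonglongrightarrow> 0"
      by (rule tail_op_Lp_tendsto[OF p \<alpha>(1) h hB]) (rule hcont)
    note order_tendstoD(2)[OF this \<epsilon>']
    moreover have "\<forall>\<^sub>F n in sequentially. real n - \<beta> > 0"
      by (rule eventually_shift_pos)
    ultimately show "\<forall>\<^sub>F n in sequentially.
        dist (\<integral>x. \<bar>M_op \<alpha> \<beta> n F x - f x\<bar> powr p \<partial>?L) 0 < \<epsilon>"
    proof eventually_elim
      case (elim n)
      then have n: "real n > \<beta>" by simp
      let ?T = "tail_op \<alpha> (real n - \<beta>) n"
      \<comment> \<open>The first and third terms are small for large \<open>n\<close> with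
        \<open>f\<close> and \<open>g\<close> fixed; the second and fourth are small by the choice
        of \<open>g\<close>. Only the second needs a bound uniform in \<open>n\<close>, and the
        contraction provides it.\<close>
      let ?a = "\<lambda>x. c n * psi n 0 x" and ?b = "?T (\<lambda>t. F t - h t)"
        and ?c = "\<lambda>x. ?T h x - h x" and ?d = "\<lambda>x. h x - f x"
      have eq: "M_op \<alpha> \<beta> n F x - f x = ?a x + (?b x + (?c x + ?d x))" if "x \<in> space ?L" for x
        using M[OF n, of x] tail_op_diff[OF \<alpha>(1) mn(2)[OF n] _ F h, of x n] that by simp
      have cm: "?c \<in> borel_measurable ?L" and dm: "?d \<in> borel_measurable ?L"
        using hm tailm f by auto
      have bi: "integrable ?L (\<lambda>x. \<bar>?b x\<bar> powr p)"
        by (rule tail_op_contraction(1)[OF \<alpha>(1) mn(2,3)[OF n] Fh p Fhp])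
      have b: "(\<integral>x. \<bar>?b x\<bar> powr p \<partial>?L) < \<epsilon>'"
        using tail_op_contraction(2)[OF \<alpha>(1) mn(2,3)[OF n] Fh p Fhp, of R] fg Fh_int by simp
      have d: "(\<integral>x. \<bar>?d x\<bar> powr p \<partial>?L) < \<epsilon>'"
        using hf_int fg by simp
      have hi: "integrable lebesgue (\<lambda>t. \<bar>h t\<bar> powr p)"
        unfolding h_def using gp by (simp add: zero_ext_powr_integrable)
      have "integrable ?L (\<lambda>x. \<bar>?T h x\<bar> powr p)"
        by (rule tail_op_contraction(1)[OF \<alpha>(1) mn(2,3)[OF n] h p hi])
      then have ci: "integrable ?L (\<lambda>x. \<bar>?c x\<bar> powr p)"
        using powr_integral_add(1)[OF p0(1) tailm, of "\<lambda>x. - h x"] hm hp by simp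
      note cd = powr_integral_add[OF p0(1) cm dm ci hf, folded P_def]
      have cdm: "(\<lambda>x. ?c x + ?d x) \<in> borel_measurable ?L"
        by (intro borel_measurable_add cm dm)
      note bcd = powr_integral_add[OF p0(1) tailm cdm bi cd(1), folded P_def]
      have bcdm: "(\<lambda>x. ?b x + (?c x + ?d x)) \<in> borel_measurable ?L"
        by (intro borel_measurable_add tailm cdm)
      note abcd = powr_integral_add(2)[OF p0(1) headm bcdm headi[OF n] bcd(1), folded P_def]
      have P0: "P > 0" using P by simp
      have "(\<integral>x. \<bar>?c x + ?d x\<bar> powr p \<partial>?L) < P * (\<epsilon>' + \<epsilon>')"
        using elim d by (intro le_less_trans[OF cd(2)] mult_strict_left_mono P0) auto
      then have "(\<integral>x. \<bar>?b x + (?c x + ?d x)\<bar> powr p \<partial>?L) < P * (\<epsilon>' + P * (\<epsilon>' + \<epsilon>'))"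
        using b by (intro le_less_trans[OF bcd(2)] mult_strict_left_mono P0 add_strict_mono)
      then have "(\<integral>x. \<bar>?a x + (?b x + (?c x + ?d x))\<bar> powr p \<partial>?L)
          < P * (\<epsilon>' + P * (\<epsilon>' + P * (\<epsilon>' + \<epsilon>')))"
        using elim by (intro le_less_trans[OF abcd] mult_strict_left_mono P0 add_strict_mono)
      also have "\<dots> = \<epsilon>' * P + \<epsilon>' * P ^ 2 + 2 * \<epsilon>' * P ^ 3"
        by (simp add: algebra_simps power2_eq_square power3_eq_cube)
      also have "\<dots> \<le> \<epsilon>' * P ^ 3 + \<epsilon>' * P ^ 3 + 2 * \<epsilon>' * P ^ 3"
        using power_increasing[of 1 3 P] power_increasing[of 2 3 P] P \<epsilon>'
        by (intro add_mono mult_left_mono) auto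
      also have "\<dots> = \<epsilon>"
        using P by (simp add: \<epsilon>'_def)
      finally have "(\<integral>x. \<bar>?a x + (?b x + (?c x + ?d x))\<bar> powr p \<partial>?L) < \<epsilon>" .
      moreover have "(\<integral>x. \<bar>M_op \<alpha> \<beta> n F x - f x\<bar> powr p \<partial>?L)
          = (\<integral>x. \<bar>?a x + (?b x + (?c x + ?d x))\<bar> powr p \<partial>?L)"
        by (intro Bochner_Integration.integral_cong refl) (simp only: eq)
      ultimately show ?case
        by (simp add: integral_nonneg_AE)
    qed
  qed
  have "(\<lambda>n. Lp_norm p {0..R} (\<lambda>x. M_op \<alpha> \<beta> n F x - f x)) \<longlonglongrightarrow> 0"
    using powr_tendsto_0[OF _ lim, of "1 / p"] p0 by (simp add: Lp_norm_def integral_nonneg_AE)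
  with summ Lp show ?thesis
    unfolding F_def by (intro conjI allI impI)
qed

end
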